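(* Let $\mathbb K$ be a field and let $M$ be a finitely generated, cancellative binoid that is torsion-free up to nilpotence. Let $i:\operatorname{Spec}M\to\operatorname{Spec}\mathbb K[M]$ be the continuous map $\mathfrak p\mapsto\mathbb K[\mathfrak p]$. For any sheaf of abelian groups $\mathscr F$ on $\operatorname{Spec}M$, \[ \mathrm H^j(\operatorname{Spec}\mathbb K[M],i_*\mathscr F)=0 \] for all $j\geq1$.
   Context: A (commutative) binoid is a commutative monoid $(M,+,0)$ with an absorbing element $\infty$; $M^\bullet=M\smallsetminus\{\infty\}$. $M$ is cancellative if $a+b=a+c\neq\infty$ implies $b=c$, and torsion-free up to nilpotence if $na=nb\neq\infty$ with $n\geq1$ implies $a=b$. A prime ideal of $M$ is a subset $\mathfrak p\ni\infty$ with $\mathfrak p+M\subseteq\mathfrak p$ and $M\smallsetminus\mathfrak p$ a submonoid; $\operatorname{Spec}M$ is the set of prime ideals with the Zariski topology, with basis the sets $D(f)=\{\mathfrak p\mid f\notin\mathfrak p\}$, $f\in M$. The binoid algebra $\mathbb K[M]$ is the $\mathbb K$-algebra with $\mathbb K$-basis $\{T^a\mid a\in M^\bullet\}$ and multiplication $T^aT^b=T^{a+b}$, where $T^\infty=0$. For a prime ideal $\mathfrak p$ of $M$, $\mathbb K[\mathfrak p]$ is the (prime) ideal of $\mathbb K[M]$ spanned by the $T^a$ with $a\in\mathfrak p$. $\mathrm H^j$ is sheaf cohomology on $\operatorname{Spec}\mathbb K[M]$ with the Zariski topology. *)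

theory Defs
  imports
    "HOL-Analysis.Abstract_Topology"
    "HOL-Algebra.Elementary_Groups"
    "HOL-Algebra.Ideal"
    "HOL-Library.Poly_Mapping"
begin

section \<open>Binoids\<close>

text \<open>The neutral element is \<open>0\<close>; \<open>0 = binf\<close> is not excluded (the zero binoid).\<close>

class binoid = comm_monoid_add +
  fixes binf :: 'a
  assumes binf_absorbing: "a + binf = binf"

inductive_set subbinoid_generated :: "'m::binoid set \<Rightarrow> 'm set" for S :: "'m set" where
  zero: "0 \<in> subbinoid_generated S"
| infinity: "binf \<in> subbinoid_generated S"
| gen: "a \<in> S \<Longrightarrow> a \<in> subbinoid_generated S"
| add: "a \<in> subbinoid_generated S \<Longrightarrow> b \<in> subbinoid_generated S \<Longrightarrow> a + b \<in> subbinoid_generated S"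

definition finitely_generated_binoid :: "'m::binoid itself \<Rightarrow> bool" where
  "finitely_generated_binoid _ \<longleftrightarrow> (\<exists>S::'m set. finite S \<and> subbinoid_generated S = UNIV)"

definition cancellative_binoid :: "'m::binoid itself \<Rightarrow> bool" where
  "cancellative_binoid _ \<longleftrightarrow> (\<forall>a b c::'m. a + b = a + c \<and> a + c \<noteq> binf \<longrightarrow> b = c)"

definition nat_multiple :: "nat \<Rightarrow> 'm::comm_monoid_add \<Rightarrow> 'm" where
  "nat_multiple n a = (\<Sum>i<n. a)"

definition torsion_free_up_to_nilpotence :: "'m::binoid itself \<Rightarrow> bool" where
  "torsion_free_up_to_nilpotence _ \<longleftrightarrow>
     (\<forall>(a::'m) b n. n \<ge> 1 \<and> nat_multiple n a = nat_multiple n b \<and> nat_multiple n b \<noteq> binf \<longrightarrow> a = b)"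

definition binoid_prime_ideal :: "'m::binoid set \<Rightarrow> bool" where
  "binoid_prime_ideal p \<longleftrightarrow>
     binf \<in> p \<and> (\<forall>a\<in>p. \<forall>b. a + b \<in> p) \<and>
     0 \<notin> p \<and> (\<forall>a b. a \<notin> p \<and> b \<notin> p \<longrightarrow> a + b \<notin> p)"

definition binoid_Spec :: "'m::binoid set set" where
  "binoid_Spec = {p. binoid_prime_ideal p}"

definition binoid_Zariski :: "'m::binoid set topology" where
  "binoid_Zariski = topology_generated_by (range (\<lambda>f::'m. {p \<in> binoid_Spec. f \<notin> p}))"

lemma topspace_binoid_Zariski: "topspace binoid_Zariski = (binoid_Spec :: 'm::binoid set set)"
  unfolding binoid_Zariski_def topology_generated_by_topspace
  by (auto simp: binoid_Spec_def binoid_prime_ideal_def)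


section \<open>The binoid algebra\<close>

text \<open>
  The basis element \<open>T\<^sup>a\<close> is \<open>Poly_Mapping.single a 1\<close>. Products are taken in the monoid algebra
  \<open>'m \<Rightarrow>\<^sub>0 'k\<close> of all of \<open>M\<close>, after which the coefficient at \<open>\<infinity>\<close> is discarded (\<open>T\<^sup>\<infinity> = 0\<close>).
\<close>

definition drop_infinity :: "('m::binoid \<Rightarrow>\<^sub>0 'k::field) \<Rightarrow> ('m \<Rightarrow>\<^sub>0 'k)" where
  "drop_infinity f = f - Poly_Mapping.single binf (Poly_Mapping.lookup f binf)"

definition binoid_algebra :: "('m::binoid \<Rightarrow>\<^sub>0 'k::field) ring" where
  "binoid_algebra =
     \<lparr>carrier = {f. binf \<notin> Poly_Mapping.keys f},
      mult = (\<lambda>f g. drop_infinity (f * g)),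
      one = drop_infinity 1,
      zero = 0,
      add = (+)\<rparr>"

lemma keys_drop: "Poly_Mapping.keys (drop_infinity f) = Poly_Mapping.keys f - {binf}"
  by (auto simp: drop_infinity_def in_keys_iff lookup_minus lookup_single when_def split: if_splits)

lemma drop_id: "binf \<notin> Poly_Mapping.keys f \<Longrightarrow> drop_infinity f = f"
  by (simp add: drop_infinity_def in_keys_iff)

lemma drop_add: "drop_infinity (f + g) = drop_infinity f + drop_infinity g"
  by (simp add: drop_infinity_def lookup_add single_add)

lemma drop_single_times: "drop_infinity (Poly_Mapping.single (binf::'m::binoid) (c::'k::field) * g) = 0"
proof -
  have "Poly_Mapping.keys (Poly_Mapping.single (binf::'m) c * g) \<subseteq> {binf}"
    using keys_mult[of "Poly_Mapping.single (binf::'m) c" g]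
    by (auto simp: binf_absorbing add.commute[of binf] split: if_splits)
  then have "Poly_Mapping.keys (drop_infinity (Poly_Mapping.single (binf::'m) c * g)) = {}"
    by (auto simp: keys_drop)
  then show ?thesis by simp
qed

lemma drop_mult_left: "drop_infinity (drop_infinity f * g) = drop_infinity (f * g)"
proof -
  have "f * g = drop_infinity f * g + Poly_Mapping.single binf (Poly_Mapping.lookup f binf) * g"
    by (simp add: drop_infinity_def flip: distrib_right)
  then show ?thesis by (simp add: drop_add drop_single_times)
qed

lemma drop_mult_right: "drop_infinity (g * drop_infinity f) = drop_infinity (g * f)"
  using drop_mult_left[of f g] by (simp add: mult.commute)

lemma cring_binoid_algebra: "cring (binoid_algebra :: ('m::binoid \<Rightarrow>\<^sub>0 'k::field) ring)"
proof (rule cringI)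
  show "abelian_group (binoid_algebra :: ('m \<Rightarrow>\<^sub>0 'k) ring)"
  proof (rule abelian_groupI)
    fix x :: "'m \<Rightarrow>\<^sub>0 'k" assume x: "x \<in> carrier binoid_algebra"
    show "\<exists>y\<in>carrier binoid_algebra. y \<oplus>\<^bsub>binoid_algebra\<^esub> x = \<zero>\<^bsub>binoid_algebra\<^esub>"
      using x by (intro bexI[of _ "-x"]) (auto simp: binoid_algebra_def)
  qed (auto simp: binoid_algebra_def algebra_simps in_keys_iff lookup_add)
  show "Group.comm_monoid (binoid_algebra :: ('m \<Rightarrow>\<^sub>0 'k) ring)"
    by (rule comm_monoidI)
      (auto simp: binoid_algebra_def keys_drop drop_mult_left drop_mult_right drop_id mult_ac)
next
  fix x y z :: "'m \<Rightarrow>\<^sub>0 'k"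
  show "(x \<oplus>\<^bsub>binoid_algebra\<^esub> y) \<otimes>\<^bsub>binoid_algebra\<^esub> z
     = x \<otimes>\<^bsub>binoid_algebra\<^esub> z \<oplus>\<^bsub>binoid_algebra\<^esub> y \<otimes>\<^bsub>binoid_algebra\<^esub> z"
    by (simp add: binoid_algebra_def distrib_right drop_add)
qed

text \<open>The \<open>\<K>\<close>-span of the \<open>T\<^sup>a\<close> with \<open>a \<in> p\<close>, \<open>a \<noteq> \<infinity>\<close>.\<close>

definition binoid_algebra_ideal :: "'m::binoid set \<Rightarrow> ('m \<Rightarrow>\<^sub>0 'k::field) set" where
  "binoid_algebra_ideal p = {f \<in> carrier binoid_algebra. Poly_Mapping.keys f \<subseteq> p}"

definition ring_Spec :: "('a, 'b) ring_scheme \<Rightarrow> 'a set set" where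
  "ring_Spec R = {P. primeideal P R}"

definition ring_Zariski :: "('a, 'b) ring_scheme \<Rightarrow> 'a set topology" where
  "ring_Zariski R = topology_generated_by ((\<lambda>f. {P \<in> ring_Spec R. f \<notin> P}) ` carrier R)"

lemma topspace_ring_Zariski:
  assumes "cring R" shows "topspace (ring_Zariski R) = ring_Spec R"
proof -
  interpret cring R by fact
  have "\<one>\<^bsub>R\<^esub> \<notin> P" if "P \<in> ring_Spec R" for P
  proof -
    interpret primeideal P R using that by (simp add: ring_Spec_def)
    show ?thesis using I_notcarr one_imp_carrier by blast
  qed
  then show ?thesis unfolding ring_Zariski_def topology_generated_by_topspace by auto
qed


section \<open>Sheaves of abelian groups\<close>

text \<open>
  Abelian groups are written multiplicatively, following \<^locale>\<open>comm_group\<close>. \<open>restr F U V\<close> is the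
  restriction from \<open>U\<close> to \<open>V \<subseteq> U\<close>; all data are constrained only at open sets. That the groups of
  sections share one type \<open>'s\<close> is no restriction, since their carriers are independent.
\<close>

record ('x, 's) presheaf =
  sections :: "'x set \<Rightarrow> 's monoid"
  restr :: "'x set \<Rightarrow> 'x set \<Rightarrow> 's \<Rightarrow> 's"

definition abelian_presheaf :: "'x topology \<Rightarrow> ('x, 's) presheaf \<Rightarrow> bool" where
  "abelian_presheaf X F \<longleftrightarrow>
     (\<forall>U. openin X U \<longrightarrow> comm_group (sections F U)) \<and>
     (\<forall>U V. openin X U \<and> openin X V \<and> V \<subseteq> U \<longrightarrow> restr F U V \<in> hom (sections F U) (sections F V)) \<and>
     (\<forall>U. openin X U \<longrightarrow> (\<forall>s \<in> carrier (sections F U). restr F U U s = s)) \<and>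
     (\<forall>U V W. openin X U \<and> openin X V \<and> openin X W \<and> W \<subseteq> V \<and> V \<subseteq> U \<longrightarrow>
        (\<forall>s \<in> carrier (sections F U). restr F V W (restr F U V s) = restr F U W s))"

text \<open>Coverings are given as sets \<open>\<U>\<close> of open sets; the empty covering forces \<open>F(\<emptyset>)\<close> to be trivial.\<close>

definition abelian_sheaf :: "'x topology \<Rightarrow> ('x, 's) presheaf \<Rightarrow> bool" where
  "abelian_sheaf X F \<longleftrightarrow>
     abelian_presheaf X F \<and>
     (\<forall>\<U>. (\<forall>U\<in>\<U>. openin X U) \<longrightarrow>
        (\<forall>s \<in> carrier (sections F (\<Union>\<U>)). \<forall>t \<in> carrier (sections F (\<Union>\<U>)).
           (\<forall>U\<in>\<U>. restr F (\<Union>\<U>) U s = restr F (\<Union>\<U>) U t) \<longrightarrow> s = t) \<and>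
        (\<forall>s. (\<forall>U\<in>\<U>. s U \<in> carrier (sections F U)) \<and>
             (\<forall>U\<in>\<U>. \<forall>V\<in>\<U>. restr F U (U \<inter> V) (s U) = restr F V (U \<inter> V) (s V)) \<longrightarrow>
           (\<exists>t \<in> carrier (sections F (\<Union>\<U>)). \<forall>U\<in>\<U>. restr F (\<Union>\<U>) U t = s U)))"

definition pushforward :: "'x topology \<Rightarrow> ('x \<Rightarrow> 'y) \<Rightarrow> ('x, 's) presheaf \<Rightarrow> ('y, 's) presheaf" where
  "pushforward X f F =
     \<lparr>sections = (\<lambda>V. sections F {x \<in> topspace X. f x \<in> V}),
      restr = (\<lambda>V W. restr F {x \<in> topspace X. f x \<in> V} {x \<in> topspace X. f x \<in> W})\<rparr>"

definition sheaf_hom ::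
  "'x topology \<Rightarrow> ('x, 's) presheaf \<Rightarrow> ('x, 't) presheaf \<Rightarrow> ('x set \<Rightarrow> 's \<Rightarrow> 't) \<Rightarrow> bool" where
  "sheaf_hom X F G \<phi> \<longleftrightarrow>
     (\<forall>U. openin X U \<longrightarrow> \<phi> U \<in> hom (sections F U) (sections G U)) \<and>
     (\<forall>U V. openin X U \<and> openin X V \<and> V \<subseteq> U \<longrightarrow>
        (\<forall>s \<in> carrier (sections F U). \<phi> V (restr F U V s) = restr G U V (\<phi> U s)))"

definition sheaf_mono ::
  "'x topology \<Rightarrow> ('x, 's) presheaf \<Rightarrow> ('x, 't) presheaf \<Rightarrow> ('x set \<Rightarrow> 's \<Rightarrow> 't) \<Rightarrow> bool" where
  "sheaf_mono X F G \<phi> \<longleftrightarrow>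
     sheaf_hom X F G \<phi> \<and> (\<forall>U. openin X U \<longrightarrow> inj_on (\<phi> U) (carrier (sections F U)))"

definition sheaf_kernel ::
  "('x, 's) presheaf \<Rightarrow> ('x, 't) presheaf \<Rightarrow> ('x set \<Rightarrow> 's \<Rightarrow> 't) \<Rightarrow> 'x set \<Rightarrow> 's set" where
  "sheaf_kernel F G \<phi> U = kernel (sections F U) (sections G U) (\<phi> U)"

text \<open>
  The image sheaf is the subsheaf of \<open>G\<close> associated with the presheaf image: its sections are the
  sections of \<open>G\<close> lying in the image of \<open>\<phi>\<close> locally.
\<close>

definition sheaf_image ::
  "'x topology \<Rightarrow> ('x, 's) presheaf \<Rightarrow> ('x, 't) presheaf \<Rightarrow> ('x set \<Rightarrow> 's \<Rightarrow> 't) \<Rightarrow> 'x set \<Rightarrow> 't set" where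
  "sheaf_image X F G \<phi> U =
     {t \<in> carrier (sections G U).
        \<forall>x\<in>U. \<exists>V. openin X V \<and> x \<in> V \<and> V \<subseteq> U \<and> restr G U V t \<in> \<phi> V ` carrier (sections F V)}"

definition sheaf_exact ::
  "'x topology \<Rightarrow> ('x, 's) presheaf \<Rightarrow> ('x, 't) presheaf \<Rightarrow> ('x, 'u) presheaf \<Rightarrow>
   ('x set \<Rightarrow> 's \<Rightarrow> 't) \<Rightarrow> ('x set \<Rightarrow> 't \<Rightarrow> 'u) \<Rightarrow> bool" where
  "sheaf_exact X F G H \<phi> \<psi> \<longleftrightarrow>
     (\<forall>U. openin X U \<longrightarrow> sheaf_image X F G \<phi> U = sheaf_kernel G H \<psi> U)"


section \<open>Sheaf cohomology\<close>

text \<open>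
  Injectivity is the lifting property against monomorphisms \<open>A \<rightarrow> B\<close> of abelian sheaves. A HOL
  definition cannot quantify over all types of sections, so the sections of \<open>A\<close> and \<open>B\<close> are taken
  in \<open>'x \<Rightarrow> int\<close>. This type is large enough to give injectivity without any restriction on types:
  it accommodates every subsheaf of the sheaves \<open>\<int>\<^sub>U\<close> (extension by zero of the constant sheaf on an
  open set \<open>U\<close>), whose sections over \<open>V\<close> are the locally constant functions \<open>V \<rightarrow> \<int>\<close> with support
  contained in \<open>U\<close>. These generate the Grothendieck category of abelian sheaves, and it suffices to
  test injectivity on the subobjects of a family of generators.
\<close>

definition injective_sheaf :: "'x topology \<Rightarrow> ('x, 's) presheaf \<Rightarrow> bool" where
  "injective_sheaf X I \<longleftrightarrow>
     abelian_sheaf X I \<and>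
     (\<forall>(A :: ('x, 'x \<Rightarrow> int) presheaf) (B :: ('x, 'x \<Rightarrow> int) presheaf) \<phi> \<psi>.
        abelian_sheaf X A \<and> abelian_sheaf X B \<and> sheaf_mono X A B \<phi> \<and> sheaf_hom X A I \<psi> \<longrightarrow>
        (\<exists>\<theta>. sheaf_hom X B I \<theta> \<and>
           (\<forall>U. openin X U \<longrightarrow> (\<forall>a \<in> carrier (sections A U). \<theta> U (\<phi> U a) = \<psi> U a))))"

text \<open>\<open>0 \<rightarrow> F \<rightarrow> I\<^sup>0 \<rightarrow> I\<^sup>1 \<rightarrow> \<dots>\<close>, with \<open>d n\<close> the morphism from \<open>I n\<close> to \<open>I (Suc n)\<close>.\<close>

definition injective_resolution ::
  "'x topology \<Rightarrow> ('x, 's) presheaf \<Rightarrow> ('x set \<Rightarrow> 's \<Rightarrow> 't) \<Rightarrow>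
   (nat \<Rightarrow> ('x, 't) presheaf) \<Rightarrow> (nat \<Rightarrow> 'x set \<Rightarrow> 't \<Rightarrow> 't) \<Rightarrow> bool" where
  "injective_resolution X F \<epsilon> I d \<longleftrightarrow>
     abelian_sheaf X F \<and>
     (\<forall>n. injective_sheaf X (I n)) \<and>
     (\<forall>n. sheaf_hom X (I n) (I (Suc n)) (d n)) \<and>
     sheaf_mono X F (I 0) \<epsilon> \<and>
     sheaf_exact X F (I 0) (I 1) \<epsilon> (d 0) \<and>
     (\<forall>n. sheaf_exact X (I n) (I (Suc n)) (I (Suc (Suc n))) (d n) (d (Suc n)))"

text \<open>
  Cohomology of the complex of global sections of \<open>I\<close>. If \<open>I\<close>, \<open>d\<close> form an injective resolution
  of \<open>F\<close>, the group \<open>sheaf_cohomology X I d j\<close> is \<open>H\<^sup>j(X, F)\<close>, the \<open>j\<close>-th right derived functor of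
  the global sections functor at \<open>F\<close>. It depends on the resolution only up to isomorphism.
\<close>

definition global_cocycles ::
  "'x topology \<Rightarrow> (nat \<Rightarrow> ('x, 't) presheaf) \<Rightarrow> (nat \<Rightarrow> 'x set \<Rightarrow> 't \<Rightarrow> 't) \<Rightarrow> nat \<Rightarrow> 't set" where
  "global_cocycles X I d j =
     kernel (sections (I j) (topspace X)) (sections (I (Suc j)) (topspace X)) (d j (topspace X))"

definition global_coboundaries ::
  "'x topology \<Rightarrow> (nat \<Rightarrow> ('x, 't) presheaf) \<Rightarrow> (nat \<Rightarrow> 'x set \<Rightarrow> 't \<Rightarrow> 't) \<Rightarrow> nat \<Rightarrow> 't set" where
  "global_coboundaries X I d j =
     (case j of
        0 \<Rightarrow> {\<one>\<^bsub>sections (I 0) (topspace X)\<^esub>}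
      | Suc k \<Rightarrow> d k (topspace X) ` carrier (sections (I k) (topspace X)))"

definition sheaf_cohomology ::
  "'x topology \<Rightarrow> (nat \<Rightarrow> ('x, 't) presheaf) \<Rightarrow> (nat \<Rightarrow> 'x set \<Rightarrow> 't \<Rightarrow> 't) \<Rightarrow> nat \<Rightarrow> 't set monoid" where
  "sheaf_cohomology X I d j =
     (sections (I j) (topspace X))\<lparr>carrier := global_cocycles X I d j\<rparr> Mod global_coboundaries X I d j"

end

theory Submission
  imports Defs
begin

text \<open>
  For a prime ideal \<open>P\<close> of \<open>\<K>[M]\<close> let \<open>r P = {a. T\<^sup>a \<in> P}\<close>, a prime ideal of \<open>M\<close> with
  \<open>\<K>[r P] \<subseteq> P\<close>. Every open neighbourhood of \<open>P\<close> contains \<open>\<K>[r P]\<close>, and \<open>P\<close> has arbitrarily small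
  neighbourhoods \<open>W\<close> such that the trace of \<open>W\<close> on \<open>Spec M\<close> lies in every open set containing
  \<open>r P\<close>. Shrinking such a \<open>W\<close> to a smaller neighbourhood \<open>V\<close> of \<open>\<K>[r P]\<close> does not change the trace,
  so \<open>i\<^sub>*F\<close> has the same sections over \<open>V\<close> and \<open>W\<close>.

  Let \<open>I\<close> be an injective, hence flasque, resolution of \<open>i\<^sub>*F\<close>. By induction on \<open>n\<close>, every
  \<open>(n+1)\<close>-cocycle over such a \<open>W\<close> is a coboundary: it has a primitive near the point \<open>\<K>[r P]\<close>, and
  a primitive over \<open>V\<close> extends across a small neighbourhood \<open>N\<close> of a point of \<open>W\<close>, because its
  difference on \<open>V \<inter> N\<close> to a primitive over \<open>N\<close> is an \<open>n\<close>-cocycle that extends to \<open>N\<close> (for \<open>n = 0\<close>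
  as a section of \<open>i\<^sub>*F\<close>, for \<open>n > 0\<close> because it is a coboundary and \<open>I\<close> is flasque). Finally \<open>Spec \<K>[M]\<close>
  is itself such a \<open>W\<close>, around the ideal spanned by the nonunits of \<open>M\<close>.
\<close>

section \<open>Prime ideals of the binoid algebra\<close>

lemma nat_multiple_0: "nat_multiple 0 a = 0"
  and nat_multiple_Suc: "nat_multiple (Suc n) a = a + nat_multiple n a"
  by (simp_all add: nat_multiple_def add.commute)

lemma nat_multiple_1: "nat_multiple (Suc 0) a = a"
  by (simp add: nat_multiple_def)

lemma nat_multiple_distrib: "nat_multiple n (a + b) = nat_multiple n a + nat_multiple n b"
  by (simp add: nat_multiple_def sum.distrib)

lemma nat_multiple_add: "nat_multiple (m + n) a = nat_multiple m a + nat_multiple n a"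
  by (induction m) (simp_all add: nat_multiple_0 nat_multiple_Suc add.assoc)

lemma nat_multiple_commute: "nat_multiple m (nat_multiple n a) = nat_multiple n (nat_multiple m a)"
  unfolding nat_multiple_def by (rule sum.swap)

section \<open>Ordering a torsion-free cancellative monoid\<close>

text \<open>
  A pair \<open>(a, b)\<close> of a cone stands for the positive element \<open>a - b\<close> of the difference group.
\<close>

definition difference_cone :: "'m::comm_monoid_add set \<Rightarrow> ('m \<times> 'm) set \<Rightarrow> bool" where
  "difference_cone N C \<longleftrightarrow> C \<subseteq> N \<times> N \<and> (\<forall>a. (a, a) \<notin> C) \<and>
     (\<forall>a b c d. (a, b) \<in> C \<and> (c, d) \<in> C \<longrightarrow> (a + c, b + d) \<in> C)"

lemma difference_coneD:
  assumes "difference_cone N C"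
  shows "(a, b) \<in> C \<Longrightarrow> a \<in> N" "(a, b) \<in> C \<Longrightarrow> b \<in> N" "(a, a) \<notin> C"
    "(a, b) \<in> C \<Longrightarrow> (c, d) \<in> C \<Longrightarrow> (a + c, b + d) \<in> C"
  using assms unfolding difference_cone_def by blast+

lemma difference_cone_multiple:
  assumes "difference_cone N C" "(a, b) \<in> C"
  shows "(nat_multiple (Suc n) a, nat_multiple (Suc n) b) \<in> C"
proof (induction n)
  case 0 then show ?case using assms(2) by (simp add: nat_multiple_1)
next
  case (Suc n)
  then show ?case
    using difference_coneD(4)[OF assms Suc] by (simp add: nat_multiple_Suc[of "Suc n"])
qed

text \<open>Zorn's lemma applies because two pairs in the union of a chain already lie in one
  member, so the union is again closed under addition and misses the diagonal.\<close>

lemma maximal_difference_cone: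
  obtains C where "difference_cone N C" "\<And>D. difference_cone N D \<Longrightarrow> C \<subseteq> D \<Longrightarrow> D = C"
proof -
  have "\<exists>M\<in>{C. difference_cone N C}. \<forall>X\<in>{C. difference_cone N C}. M \<subseteq> X \<longrightarrow> X = M"
  proof (rule subset_Zorn')
    fix \<C> assume ch: "subset.chain {C. difference_cone N C} \<C>"
    then have cone: "\<And>C. C \<in> \<C> \<Longrightarrow> difference_cone N C" by (auto simp: subset_chain_def)
    have "difference_cone N (\<Union>\<C>)"
      unfolding difference_cone_def
    proof (intro conjI allI impI)
      show "\<Union>\<C> \<subseteq> N \<times> N" using cone unfolding difference_cone_def by blast
      show "(a, a) \<notin> \<Union>\<C>" for a using cone difference_coneD(3) by blast
      fix a b c d assume "(a, b) \<in> \<Union>\<C> \<and> (c, d) \<in> \<Union>\<C>"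
      then obtain C D where CD: "C \<in> \<C>" "D \<in> \<C>" "(a, b) \<in> C" "(c, d) \<in> D" by blast
      with ch have "C \<subseteq> D \<or> D \<subseteq> C" by (auto simp: subset_chain_def)
      then show "(a + c, b + d) \<in> \<Union>\<C>"
        using CD cone difference_coneD(4) by (metis UnionI subsetD)
    qed
    then show "\<Union>\<C> \<in> {C. difference_cone N C}" by simp
  qed
  then show ?thesis using that by auto
qed

text \<open>\<open>N\<close> is a subset of the type because it will be the complement of a prime
  ideal, which takes its addition from the binoid.\<close>

locale torsion_free_cancellative =
  fixes N :: "'m::comm_monoid_add set"
  assumes zero_mem: "0 \<in> N"
    and add_mem: "a \<in> N \<Longrightarrow> b \<in> N \<Longrightarrow> a + b \<in> N"
    and cancel: "a \<in> N \<Longrightarrow> b \<in> N \<Longrightarrow> c \<in> N \<Longrightarrow> a + b = a + c \<Longrightarrow> b = c"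
    and torsion_free: "a \<in> N \<Longrightarrow> b \<in> N \<Longrightarrow> nat_multiple (Suc n) a = nat_multiple (Suc n) b \<Longrightarrow> a = b"
begin

lemma nat_multiple_mem: "a \<in> N \<Longrightarrow> nat_multiple n a \<in> N"
  by (induction n) (auto simp: nat_multiple_0 nat_multiple_Suc zero_mem add_mem)

text \<open>Adjoining \<open>(x, y)\<close> to the maximal \<open>C\<close> must destroy the cone
  property. The enlarged set is still closed under addition, so it has to meet the diagonal, and
  that is the asserted equation.\<close>

lemma cone_extension_obstructed:
  assumes C: "difference_cone N C" and max: "\<And>D. difference_cone N D \<Longrightarrow> C \<subseteq> D \<Longrightarrow> D = C"
    and x: "x \<in> N" and y: "y \<in> N" "x \<noteq> y" "(x, y) \<notin> C"
  shows "\<exists>n a b. (a, b) \<in> C \<and> nat_multiple (Suc n) x + a = nat_multiple (Suc n) y + b"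
proof (rule ccontr)
  assume no: "\<not> ?thesis"
  \<comment> \<open>The pair \<open>(0, 0)\<close> admits the multiples of \<open>(x, y)\<close> by
    themselves, and \<open>Suc n\<close> keeps the multiplicity of \<open>(x, y)\<close>
    positive.\<close>
  define D where "D = C \<union> {(nat_multiple (Suc n) x + a, nat_multiple (Suc n) y + b) | n a b.
    (a, b) \<in> insert (0, 0) C}"
  have D_gen: "(nat_multiple (Suc n) x + a, nat_multiple (Suc n) y + b) \<in> D"
    if "(a, b) \<in> insert (0, 0) C" for n a b using that unfolding D_def by blast
  have D_cases: "(u, v) \<in> C \<or> (\<exists>n a b. u = nat_multiple (Suc n) x + a \<and>
      v = nat_multiple (Suc n) y + b \<and> (a, b) \<in> insert (0, 0) C)" if "(u, v) \<in> D" for u v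
    using that unfolding D_def by blast
  have C0: "(a + c, b + d) \<in> insert (0, 0) C"
    if "(a, b) \<in> insert (0, 0) C" "(c, d) \<in> insert (0, 0) C" for a b c d
    using that difference_coneD(4)[OF C] by auto
  have C1: "(a + c, b + d) \<in> C" if "(a, b) \<in> C" "(c, d) \<in> insert (0, 0) C" for a b c d
    using that difference_coneD(4)[OF C] by auto
  have cone: "difference_cone N D" unfolding difference_cone_def
  proof (intro conjI allI impI)
    show "D \<subseteq> N \<times> N"
    proof (rule subrelI)
      fix u v assume "(u, v) \<in> D"
      from D_cases[OF this] show "(u, v) \<in> N \<times> N"
        using difference_coneD(1,2)[OF C] x y
        by (auto simp: zero_mem intro!: add_mem nat_multiple_mem)
    qed
    show "(u, u) \<notin> D" for u
    proof
      assume "(u, u) \<in> D"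
      from D_cases[OF this] show False
      proof (elim disjE exE conjE)
        assume "(u, u) \<in> C" then show False using difference_coneD(3)[OF C] by blast
      next
        fix n a b assume "u = nat_multiple (Suc n) x + a" "u = nat_multiple (Suc n) y + b"
          and ab: "(a, b) \<in> insert (0, 0) C"
        then have eq: "nat_multiple (Suc n) x + a = nat_multiple (Suc n) y + b" by (simp only:)
        show False
        proof (cases "(a, b) \<in> C")
          case True then show False using eq no by blast
        next
          case False
          \<comment> \<open>What remains is a pure multiple of \<open>(x, y)\<close>, kept off the
            diagonal by torsion-freeness.\<close>
          with ab eq have "nat_multiple (Suc n) x = nat_multiple (Suc n) y" by simp
          then show False using torsion_free[OF x y(1)] y(2) by blast
        qed
      qed
    qed
    fix a b c d assume "(a, b) \<in> D \<and> (c, d) \<in> D"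
    then have ab: "(a, b) \<in> D" and cd: "(c, d) \<in> D" by auto
    from D_cases[OF ab] show "(a + c, b + d) \<in> D"
    proof (elim disjE exE conjE)
      assume abC: "(a, b) \<in> C"
      from D_cases[OF cd] show ?thesis
      proof (elim disjE exE conjE)
        assume "(c, d) \<in> C"
        then show ?thesis using abC difference_coneD(4)[OF C] unfolding D_def by blast
      next
        fix n a' b' assume h: "c = nat_multiple (Suc n) x + a'" "d = nat_multiple (Suc n) y + b'"
          "(a', b') \<in> insert (0, 0) C"
        have "(nat_multiple (Suc n) x + (a + a'), nat_multiple (Suc n) y + (b + b')) \<in> D"
          by (rule D_gen) (use C1[OF abC h(3)] in simp)
        then show ?thesis by (simp add: h add_ac)
      qed
    next
      fix n a' b' assume h: "a = nat_multiple (Suc n) x + a'" "b = nat_multiple (Suc n) y + b'"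
        "(a', b') \<in> insert (0, 0) C"
      from D_cases[OF cd] show ?thesis
      proof (elim disjE exE conjE)
        assume cdC: "(c, d) \<in> C"
        have "(nat_multiple (Suc n) x + (c + a'), nat_multiple (Suc n) y + (d + b')) \<in> D"
          by (rule D_gen) (use C1[OF cdC h(3)] in simp)
        then show ?thesis by (simp add: h add_ac)
      next
        fix m c' d' assume k: "c = nat_multiple (Suc m) x + c'" "d = nat_multiple (Suc m) y + d'"
          "(c', d') \<in> insert (0, 0) C"
        have "(nat_multiple (Suc (Suc n + m)) x + (a' + c'),
            nat_multiple (Suc (Suc n + m)) y + (b' + d')) \<in> D"
          by (rule D_gen) (rule C0[OF h(3) k(3)])
        moreover have "Suc (Suc n + m) = Suc n + Suc m" by simp
        ultimately show ?thesis by (simp only: h k nat_multiple_add add_ac)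
      qed
    qed
  qed
  have "D = C" by (rule max[OF cone]) (auto simp: D_def)
  moreover have "(nat_multiple (Suc 0) x + 0, nat_multiple (Suc 0) y + 0) \<in> D" by (rule D_gen) simp
  ultimately show False using y by (simp add: nat_multiple_1)
qed

text \<open>The order is read off a maximal cone \<open>C\<close>: \<open>a\<close> is below
  \<open>b\<close> when \<open>(b, a)\<close> lies in \<open>C\<close>. Totality comes from
  maximality. A failure of transitivity or of translation invariance would then produce a diagonal
  pair in \<open>C\<close>.\<close>

lemma total_order_exists:
  obtains less :: "'m \<Rightarrow> 'm \<Rightarrow> bool" where
    "\<And>a. \<not> less a a"
    "\<And>a b c. less a b \<Longrightarrow> less b c \<Longrightarrow> less a c"
    "\<And>a b. a \<in> N \<Longrightarrow> b \<in> N \<Longrightarrow> a \<noteq> b \<Longrightarrow> less a b \<or> less b a"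
    "\<And>a b c. c \<in> N \<Longrightarrow> less a b \<Longrightarrow> less (a + c) (b + c)"
proof -
  obtain C where C: "difference_cone N C"
    and max: "\<And>D. difference_cone N D \<Longrightarrow> C \<subseteq> D \<Longrightarrow> D = C"
    using maximal_difference_cone by blast
  note mem = difference_coneD(1,2)[OF C] and irr = difference_coneD(3)[OF C]
    and plus = difference_coneD(4)[OF C]
  have total: "(x, y) \<in> C \<or> (y, x) \<in> C" if x: "x \<in> N" and y: "y \<in> N" and ne: "x \<noteq> y" for x y
  proof (rule ccontr)
    assume not: "\<not> ?thesis"
    obtain n a b where ab: "(a, b) \<in> C" and 1: "nat_multiple (Suc n) x + a = nat_multiple (Suc n) y + b"
      using cone_extension_obstructed[OF C max x y ne] not by blast
    obtain m c d where cd: "(c, d) \<in> C" and 2: "nat_multiple (Suc m) y + c = nat_multiple (Suc m) x + d"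
      using cone_extension_obstructed[OF C max y x ne[symmetric]] not by blast
    let ?m = "nat_multiple (Suc m)" and ?n = "nat_multiple (Suc n)"
    \<comment> \<open>Add \<open>Suc m\<close> times the first relation to \<open>Suc n\<close>
      times the second. Both sides then contain the same multiples of \<open>x\<close> and
      \<open>y\<close>, and cancelling these leaves a diagonal element of \<open>C\<close>.\<close>
    have in_C: "(?m a + ?n c, ?m b + ?n d) \<in> C"
      by (intro plus difference_cone_multiple[OF C] ab cd)
    have "?m (?n x) + ?m a = ?m (?n y) + ?m b"
      by (simp only: nat_multiple_distrib[symmetric] 1)
    moreover have "?n (?m y) + ?n c = ?n (?m x) + ?n d"
      by (simp only: nat_multiple_distrib[symmetric] 2)
    ultimately have sum: "(?m (?n x) + ?m a) + (?n (?m y) + ?n c) = (?m (?n y) + ?m b) + (?n (?m x) + ?n d)"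
      by (simp only:)
    have "(?m (?n x) + ?m (?n y)) + (?m a + ?n c) = (?m (?n x) + ?m a) + (?n (?m y) + ?n c)"
      by (simp only: nat_multiple_commute[of "Suc n" "Suc m"] add_ac)
    also note sum
    also have "(?m (?n y) + ?m b) + (?n (?m x) + ?n d) = (?m (?n x) + ?m (?n y)) + (?m b + ?n d)"
      by (simp only: nat_multiple_commute[of "Suc n" "Suc m"] add_ac)
    finally have "(?m (?n x) + ?m (?n y)) + (?m a + ?n c) = (?m (?n x) + ?m (?n y)) + (?m b + ?n d)" .
    then have "?m a + ?n c = ?m b + ?n d"
      by (rule cancel[rotated -1]) (use x y mem ab cd in \<open>auto intro!: add_mem nat_multiple_mem\<close>)
    then show False using in_C irr by simp
  qed
  show ?thesis
  proof (rule that[of "\<lambda>a b. (b, a) \<in> C"])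
    show "(a, a) \<notin> C" for a by (rule irr)
    show "(a, b) \<in> C \<or> (b, a) \<in> C" if "b \<in> N" "a \<in> N" "b \<noteq> a" for a b
      using total that by blast
    show "(b + c, a + c) \<in> C" if c: "c \<in> N" and ba: "(b, a) \<in> C" for a b c
    proof (rule ccontr)
      assume n: "(b + c, a + c) \<notin> C"
      have ne: "b + c \<noteq> a + c"
        using cancel[OF c mem[OF ba]] ba irr by (metis add.commute)
      have "(a + c, b + c) \<in> C" using n ne total[of "b + c" "a + c"] mem[OF ba] c add_mem by blast
      from plus[OF ba this] show False using irr by (simp add: add_ac)
    qed
    show "(c, a) \<in> C" if ba: "(b, a) \<in> C" and cb: "(c, b) \<in> C" for a b c
    proof (rule ccontr)
      assume n: "(c, a) \<notin> C"
      note sum = plus[OF ba cb]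
      have "c = a \<or> (a, c) \<in> C" using n total mem ba cb by blast
      then show False
      proof
        assume "c = a" then show False using sum irr by (simp add: add_ac)
      next
        assume "(a, c) \<in> C" from plus[OF this sum] show False using irr by (simp add: add_ac)
      qed
    qed
  qed
qed

text \<open>Take the maxima of \<open>A\<close> and \<open>B\<close> for the total order: replacing
  a summand by a smaller one strictly lowers the sum. This provides a term in a product of two
  polynomials that nothing can cancel.\<close>

lemma unique_sum_exists:
  assumes "finite A" "A \<noteq> {}" "A \<subseteq> N" "finite B" "B \<noteq> {}" "B \<subseteq> N"
  obtains a b where "a \<in> A" "b \<in> B"
    "\<And>a' b'. a' \<in> A \<Longrightarrow> b' \<in> B \<Longrightarrow> a' + b' = a + b \<Longrightarrow> a' = a \<and> b' = b"
proof -
  obtain less where irr: "\<And>a. \<not> less a a"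
    and trans: "\<And>a b c. less a b \<Longrightarrow> less b c \<Longrightarrow> less a c"
    and tot: "\<And>a b. a \<in> N \<Longrightarrow> b \<in> N \<Longrightarrow> a \<noteq> b \<Longrightarrow> less a b \<or> less b a"
    and mono: "\<And>a b c. c \<in> N \<Longrightarrow> less a b \<Longrightarrow> less (a + c) (b + c)"
    by (rule total_order_exists) (rule that)
  have maxi: "\<exists>m\<in>S. \<forall>s\<in>S. s = m \<or> less s m" if "finite S" "S \<noteq> {}" "S \<subseteq> N" for S
    using that
  proof (induction rule: finite_ne_induct)
    case (insert x S)
    then obtain m where m: "m \<in> S" "\<forall>s\<in>S. s = m \<or> less s m" by auto
    show ?case
    proof (cases "less m x")
      case True
      have "\<forall>s\<in>insert x S. s = x \<or> less s x" using m(2) True trans[of _ m x] by auto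
      then show ?thesis by blast
    next
      case False
      then have "x = m \<or> less x m" using tot[of x m] insert.prems m(1) by auto
      then show ?thesis using m by blast
    qed
  qed simp
  obtain a where a: "a \<in> A" "\<forall>s\<in>A. s = a \<or> less s a" using maxi[OF assms(1-3)] by blast
  obtain b where b: "b \<in> B" "\<forall>s\<in>B. s = b \<or> less s b" using maxi[OF assms(4-6)] by blast
  show ?thesis
  proof (rule that[OF a(1) b(1)])
    fix a' b' assume h: "a' \<in> A" "b' \<in> B" "a' + b' = a + b"
    have N: "a' \<in> N" "b' \<in> N" "a \<in> N" "b \<in> N" using h a b assms by auto
    have b_eq: "b' = b" if "a' = a" using that cancel[OF N(3), of b' b] N h(3) by blast
    have "a' = a"
    proof (rule ccontr)
      assume "a' \<noteq> a"
      then have 1: "less (a' + b') (a + b')" using a(2) h(1) mono[OF N(2)] by blast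
      have "a + b' = a + b \<or> less (a + b') (a + b)"
        using b h mono[OF N(3), of b' b] by (auto simp: add.commute)
      then show False using 1 h(3) irr trans[OF 1, of "a + b"] by auto
    qed
    then show "a' = a \<and> b' = b" using b_eq by simp
  qed
qed

end

section \<open>Primality of \<K>[p]\<close>

lemma binoid_prime_idealD:
  assumes "binoid_prime_ideal p"
  shows "binf \<in> p" "a \<in> p \<Longrightarrow> a + b \<in> p" "a \<in> p \<Longrightarrow> b + a \<in> p" "0 \<notin> p" "a + b \<in> p \<Longrightarrow> a \<in> p \<or> b \<in> p"
  using assms unfolding binoid_prime_ideal_def by (auto simp: add.commute)

text \<open>Sums and multiples of elements outside \<open>p\<close> stay outside \<open>p\<close>,
  hence differ from \<infinity>. The provisos \<open>\<noteq> binf\<close> in the two conditions on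
  the binoid therefore hold automatically on the complement.\<close>

lemma torsion_free_cancellative_prime_complement:
  fixes p :: "'m::binoid set"
  assumes "cancellative_binoid TYPE('m)" "torsion_free_up_to_nilpotence TYPE('m)" "binoid_prime_ideal p"
  shows "torsion_free_cancellative (- p)"
proof
  note p = binoid_prime_idealD[OF assms(3)]
  show "0 \<in> - p" using p by simp
  show add: "a + b \<in> - p" if "a \<in> - p" "b \<in> - p" for a b using p(5) that by blast
  show "b = c" if "a \<in> - p" "b \<in> - p" "c \<in> - p" "a + b = a + c" for a b c
    using assms(1) that add[of a c] p(1) unfolding cancellative_binoid_def by (metis ComplD)
  show "a = b" if "a \<in> - p" "b \<in> - p" "nat_multiple (Suc n) a = nat_multiple (Suc n) b" for a b n
  proof -
    have "nat_multiple k b \<notin> p" for k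
      by (induction k) (use that add p in \<open>auto simp: nat_multiple_0 nat_multiple_Suc\<close>)
    then have "nat_multiple (Suc n) b \<noteq> binf" using p(1) by metis
    with that assms(2) show ?thesis unfolding torsion_free_up_to_nilpotence_def by (metis le_add1 plus_1_eq_Suc)
  qed
qed

text \<open>Membership only depends on the keys outside \<open>p\<close>. If both factors have such
  keys, a sum of them that arises in just one way survives in the product with nonzero coefficient
  and lies outside \<open>p\<close>.\<close>

lemma primeideal_binoid_algebra_ideal:
  fixes p :: "'m::binoid set"
  assumes "cancellative_binoid TYPE('m)" "torsion_free_up_to_nilpotence TYPE('m)"
    and p: "binoid_prime_ideal p"
  shows "primeideal (binoid_algebra_ideal p) (binoid_algebra :: ('m \<Rightarrow>\<^sub>0 'k::field) ring)"
    (is "primeideal ?I ?R")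
proof -
  interpret torsion_free_cancellative "- p" by (rule torsion_free_cancellative_prime_complement) fact+
  interpret R: cring ?R by (rule cring_binoid_algebra)
  note pD = binoid_prime_idealD[OF p]
  have carr: "carrier ?R = {f. binf \<notin> Poly_Mapping.keys f}"
    and mult: "f \<otimes>\<^bsub>?R\<^esub> g = drop_infinity (f * g)" and one: "\<one>\<^bsub>?R\<^esub> = drop_infinity 1"
    and add: "f \<oplus>\<^bsub>?R\<^esub> g = f + g" and zero: "\<zero>\<^bsub>?R\<^esub> = 0" for f g
    by (auto simp: binoid_algebra_def)
  have I: "f \<in> ?I \<longleftrightarrow> binf \<notin> Poly_Mapping.keys f \<and> Poly_Mapping.keys f \<subseteq> p" for f
    by (auto simp: binoid_algebra_ideal_def carr)
  have neg: "\<ominus>\<^bsub>?R\<^esub> f = - f" if "f \<in> carrier ?R" for f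
    by (rule R.minus_equality) (use that in \<open>auto simp: add zero carr\<close>)
  have mult_I: "f \<otimes>\<^bsub>?R\<^esub> g \<in> ?I" if g: "g \<in> ?I" for f g
  proof -
    have "{a + b | a b. a \<in> Poly_Mapping.keys f \<and> b \<in> Poly_Mapping.keys g} \<subseteq> p"
      using g pD(3) by (auto simp: I)
    then have "Poly_Mapping.keys (f * g) \<subseteq> p" using keys_mult[of f g] by (rule order_trans[rotated])
    then show ?thesis by (auto simp: I mult keys_drop)
  qed
  have "ideal ?I ?R"
  proof (rule idealI)
    show "ring ?R" ..
    show "subgroup ?I (add_monoid ?R)"
    proof (rule subgroup.intro)
      show "?I \<subseteq> carrier (add_monoid ?R)" by (auto simp: I carr)
      show "f \<otimes>\<^bsub>add_monoid ?R\<^esub> g \<in> ?I" if "f \<in> ?I" "g \<in> ?I" for f g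
        using that Poly_Mapping.keys_add[of f g] by (auto simp: I add)
      show "\<one>\<^bsub>add_monoid ?R\<^esub> \<in> ?I" by (simp add: I zero)
      show "inv\<^bsub>add_monoid ?R\<^esub> f \<in> ?I" if "f \<in> ?I" for f
      proof -
        have "f \<in> carrier ?R" using that by (simp add: I carr)
        then show ?thesis using neg[of f] that by (simp add: a_inv_def I)
      qed
    qed
    show "f \<otimes>\<^bsub>?R\<^esub> g \<in> ?I" if "g \<in> ?I" for f g using mult_I that .
    show "g \<otimes>\<^bsub>?R\<^esub> f \<in> ?I" if "g \<in> ?I" for f g using mult_I[OF that, of f] by (simp add: mult mult.commute)
  qed
  then show ?thesis
  proof (rule primeidealI)
    show "cring ?R" ..
    have "0 \<noteq> (binf :: 'm)" using pD by metis
    then have "\<one>\<^bsub>?R\<^esub> = 1" by (simp add: one drop_id)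
    then have "\<one>\<^bsub>?R\<^esub> \<notin> ?I" using pD by (simp add: I)
    then show "carrier ?R \<noteq> ?I" using R.one_closed by blast
  next
    fix f g assume f: "f \<in> carrier ?R" and g: "g \<in> carrier ?R" and fg: "f \<otimes>\<^bsub>?R\<^esub> g \<in> ?I"
    show "f \<in> ?I \<or> g \<in> ?I"
    proof (rule ccontr)
      assume not: "\<not> ?thesis"
      let ?A = "Poly_Mapping.keys f - p" and ?B = "Poly_Mapping.keys g - p"
      have "?A \<noteq> {}" "?B \<noteq> {}" using not f g by (auto simp: I carr)
      then obtain a b where a: "a \<in> ?A" and b: "b \<in> ?B"
        and uniq: "\<And>a' b'. a' \<in> ?A \<Longrightarrow> b' \<in> ?B \<Longrightarrow> a' + b' = a + b \<Longrightarrow> a' = a \<and> b' = b"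
        using unique_sum_exists[of ?A ?B] by auto
      have ab: "a + b \<notin> p" using a b pD(5) by blast
      \<comment> \<open>A key inside \<open>p\<close> only produces sums inside \<open>p\<close>,
        never \<open>a + b\<close>, so uniqueness extends to all keys.\<close>
      have uniq': "a' = a \<and> b' = b"
        if "a' \<in> Poly_Mapping.keys f" "b' \<in> Poly_Mapping.keys g" "a' + b' = a + b" for a' b'
      proof -
        have "a' \<notin> p" "b' \<notin> p" using that ab pD(2,3) by metis+
        then show ?thesis using uniq that by blast
      qed
      define fa where "fa = Poly_Mapping.single a (Poly_Mapping.lookup f a)"
      define gb where "gb = Poly_Mapping.single b (Poly_Mapping.lookup g b)"
      have keys_f: "Poly_Mapping.keys (f - fa) = Poly_Mapping.keys f - {a}"
        by (auto simp: fa_def in_keys_iff lookup_minus lookup_single when_def split: if_splits)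
      have keys_g: "Poly_Mapping.keys (g - gb) = Poly_Mapping.keys g - {b}"
        by (auto simp: gb_def in_keys_iff lookup_minus lookup_single when_def split: if_splits)
      \<comment> \<open>The product \<open>fa * gb\<close> of two monomials carries the whole
        coefficient at \<open>a + b\<close>: each of the other terms has lost the key
        \<open>a\<close> or the key \<open>b\<close> in one factor.\<close>
      have "f * g = fa * gb + (fa * (g - gb) + (f - fa) * g)" by (simp add: algebra_simps)
      moreover have "a + b \<notin> Poly_Mapping.keys (fa * (g - gb))"
      proof
        assume "a + b \<in> Poly_Mapping.keys (fa * (g - gb))"
        then obtain a' b' where h: "a' \<in> Poly_Mapping.keys fa" "b' \<in> Poly_Mapping.keys (g - gb)" "a + b = a' + b'"
          using keys_mult[of fa "g - gb"] by blast
        then have "a' = a" by (simp add: fa_def split: if_splits)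
        then show False using h a uniq'[of a b'] by (simp add: keys_g)
      qed
      moreover have "a + b \<notin> Poly_Mapping.keys ((f - fa) * g)"
      proof
        assume "a + b \<in> Poly_Mapping.keys ((f - fa) * g)"
        then obtain a' b' where h: "a' \<in> Poly_Mapping.keys (f - fa)" "b' \<in> Poly_Mapping.keys g" "a + b = a' + b'"
          using keys_mult[of "f - fa" g] by blast
        then show False using uniq'[of a' b'] by (simp add: keys_f)
      qed
      moreover have "fa * gb = Poly_Mapping.single (a + b) (Poly_Mapping.lookup f a * Poly_Mapping.lookup g b)"
        by (simp add: fa_def gb_def mult_single)
      ultimately have "a + b \<in> Poly_Mapping.keys (f * g)"
        using a b by (simp add: in_keys_iff lookup_add)
      then have "a + b \<in> Poly_Mapping.keys (drop_infinity (f * g))"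
        using ab pD(1) by (auto simp: keys_drop)
      then show False using fg ab by (auto simp: I mult)
    qed
  qed
qed

section \<open>The retraction onto the monomial primes\<close>

text \<open>The retraction \<open>r\<close> of the inclusion \<open>i\<close> of \<open>Spec M\<close> into \<open>Spec \<K>[M]\<close>.\<close>

definition monomial_prime :: "('m::binoid \<Rightarrow>\<^sub>0 'k::field) set \<Rightarrow> 'm set" where
  "monomial_prime P = {a. a = binf \<or> Poly_Mapping.single a 1 \<in> P}"

lemma single_in_binoid_algebra: "a \<noteq> binf \<Longrightarrow> Poly_Mapping.single a c \<in> carrier binoid_algebra"
  by (simp add: binoid_algebra_def)

lemma monomial_mult:
  "Poly_Mapping.single a c \<otimes>\<^bsub>binoid_algebra\<^esub> Poly_Mapping.single b d =
    (if a + b = binf then 0 else Poly_Mapping.single (a + b) (c * d))"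
  by (simp add: binoid_algebra_def mult_single drop_infinity_def lookup_single when_def)

text \<open>Multiplication of monomials is addition of exponents, so primality of \<open>P\<close>
  passes to its set of exponents. Including \<infinity> there matches
  \<open>T\<^sup>\<infinity> = 0\<close>.\<close>

lemma binoid_prime_ideal_monomial_prime:
  fixes P :: "('m::binoid \<Rightarrow>\<^sub>0 'k::field) set"
  assumes "P \<in> ring_Spec binoid_algebra"
  shows "binoid_prime_ideal (monomial_prime P)"
proof -
  let ?R = "binoid_algebra :: ('m \<Rightarrow>\<^sub>0 'k) ring"
  interpret primeideal P ?R using assms by (simp add: ring_Spec_def)
  have zero: "0 \<in> P" using additive_subgroup.zero_closed[OF additive_subgroup_axioms] by (simp add: binoid_algebra_def)
  have one: "\<one>\<^bsub>?R\<^esub> \<notin> P" using one_imp_carrier I_notcarr by blast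
  have mult: "Poly_Mapping.single (a + b) 1 \<in> P \<longleftrightarrow> Poly_Mapping.single a 1 \<in> P \<or> Poly_Mapping.single b 1 \<in> P"
    if "a + b \<noteq> binf" for a b :: 'm
  proof -
    have "a \<noteq> binf" "b \<noteq> binf" using that binf_absorbing by (metis add.commute)+
    then have "Poly_Mapping.single a 1 \<in> carrier ?R" "Poly_Mapping.single b 1 \<in> carrier ?R"
      by (simp_all add: single_in_binoid_algebra)
    then have "Poly_Mapping.single a 1 \<otimes>\<^bsub>?R\<^esub> Poly_Mapping.single b 1 \<in> P \<longleftrightarrow>
        Poly_Mapping.single a 1 \<in> P \<or> Poly_Mapping.single b 1 \<in> P"
      using I_prime[of "Poly_Mapping.single a 1" "Poly_Mapping.single b 1"]
        I_l_closed[of "Poly_Mapping.single b 1" "Poly_Mapping.single a 1"]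
        I_r_closed[of "Poly_Mapping.single a 1" "Poly_Mapping.single b 1"] by blast
    then show ?thesis using that by (simp add: monomial_mult)
  qed
  show ?thesis unfolding binoid_prime_ideal_def
  proof (intro conjI ballI allI impI)
    show "binf \<in> monomial_prime P" by (simp add: monomial_prime_def)
    show "0 \<notin> monomial_prime P"
    proof
      assume "0 \<in> monomial_prime P"
      then have "drop_infinity (1 :: 'm \<Rightarrow>\<^sub>0 'k) \<in> P"
      proof (cases "(0 :: 'm) = binf")
        \<comment> \<open>In the zero binoid the unit of the algebra is zero and hence lies in
          \<open>P\<close> as well.\<close>
        case True
        then have "drop_infinity (1 :: 'm \<Rightarrow>\<^sub>0 'k) = 0"
          by (metis single_one drop_single_times mult.right_neutral)
        then show ?thesis using zero by simp
      next
        case False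
        assume "0 \<in> monomial_prime P"
        then show ?thesis using False by (simp add: monomial_prime_def drop_id)
      qed
      then show False using one by (simp add: binoid_algebra_def)
    qed
    fix a b
    show "a + b \<in> monomial_prime P" if "a \<in> monomial_prime P"
    proof (cases "a + b = binf")
      case False
      then have "a \<noteq> binf" using binf_absorbing by (metis add.commute)
      then show ?thesis using that mult[OF False] by (simp add: monomial_prime_def)
    qed (simp add: monomial_prime_def)
    show "a + b \<notin> monomial_prime P" if "a \<notin> monomial_prime P \<and> b \<notin> monomial_prime P"
    proof
      assume ab: "a + b \<in> monomial_prime P"
      have carr: "Poly_Mapping.single a 1 \<in> carrier ?R" "Poly_Mapping.single b 1 \<in> carrier ?R"
        using that by (simp_all add: single_in_binoid_algebra monomial_prime_def)
      have "Poly_Mapping.single a 1 \<otimes>\<^bsub>?R\<^esub> Poly_Mapping.single b 1 \<in> P"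
        using ab zero by (auto simp: monomial_mult monomial_prime_def)
      then show False using I_prime[OF carr] that by (auto simp: monomial_prime_def)
    qed
  qed
qed

text \<open>Each \<open>f\<close> is the finite sum of its monomials, so it suffices that scalar
  multiples of the monomials in \<open>P\<close> lie in \<open>P\<close>.\<close>

lemma binoid_algebra_ideal_monomial_prime_subset:
  fixes P :: "('m::binoid \<Rightarrow>\<^sub>0 'k::field) set"
  assumes "P \<in> ring_Spec binoid_algebra"
  shows "binoid_algebra_ideal (monomial_prime P) \<subseteq> P"
proof
  let ?R = "binoid_algebra :: ('m \<Rightarrow>\<^sub>0 'k) ring"
  interpret primeideal P ?R using assms by (simp add: ring_Spec_def)
  have zero: "0 \<in> P" using additive_subgroup.zero_closed[OF additive_subgroup_axioms] by (simp add: binoid_algebra_def)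
  have add: "f + g \<in> P" if "f \<in> P" "g \<in> P" for f g
    using additive_subgroup.a_closed[OF additive_subgroup_axioms that] by (simp add: binoid_algebra_def)
  have "(0 :: 'm) \<notin> monomial_prime P"
    using binoid_prime_idealD(4) binoid_prime_ideal_monomial_prime assms by blast
  then have nz: "(0 :: 'm) \<noteq> binf" by (auto simp: monomial_prime_def)
  have single: "Poly_Mapping.single a c \<in> P" if "a \<in> monomial_prime P" "a \<noteq> binf" for a c
  proof -
    \<comment> \<open>\<open>P\<close> is given as an ideal, not as a subspace: the scalar
      \<open>c\<close> enters through the ring element \<open>c T\<^sup>0\<close>, which lies in the
      carrier because \<open>0\<close> is not \<infinity>.\<close>
    have "Poly_Mapping.single 0 c \<otimes>\<^bsub>?R\<^esub> Poly_Mapping.single a 1 \<in> P"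
      using that nz by (intro I_l_closed) (auto simp: monomial_prime_def single_in_binoid_algebra)
    then show ?thesis using that by (simp add: monomial_mult)
  qed
  fix f :: "'m \<Rightarrow>\<^sub>0 'k" assume "f \<in> binoid_algebra_ideal (monomial_prime P)"
  then have "Poly_Mapping.keys f \<subseteq> monomial_prime P - {binf}"
    by (auto simp: binoid_algebra_ideal_def binoid_algebra_def)
  moreover have "f = (\<Sum>a\<in>Poly_Mapping.keys f. Poly_Mapping.single a (Poly_Mapping.lookup f a))"
    by (rule poly_mapping_eqI) (simp add: lookup_sum lookup_single when_def sum.delta in_keys_iff)
  moreover have "(\<Sum>a\<in>A. Poly_Mapping.single a (Poly_Mapping.lookup f a)) \<in> P"
    if "finite A" "A \<subseteq> monomial_prime P - {binf}" for A
    using that by (induction A rule: finite_induct) (auto simp: zero single intro!: add)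
  ultimately show "f \<in> P" by (metis finite_keys)
qed

lemma single_in_binoid_algebra_ideal_iff:
  "a \<noteq> binf \<Longrightarrow> Poly_Mapping.single a 1 \<in> (binoid_algebra_ideal p :: ('m::binoid \<Rightarrow>\<^sub>0 'k::field) set) \<longleftrightarrow> a \<in> p"
  by (simp add: binoid_algebra_ideal_def single_in_binoid_algebra)

lemma monomial_prime_binoid_algebra_ideal:
  assumes "binoid_prime_ideal p"
  shows "monomial_prime (binoid_algebra_ideal p :: ('m::binoid \<Rightarrow>\<^sub>0 'k::field) set) = p"
proof (rule Set.set_eqI)
  fix a
  show "a \<in> monomial_prime (binoid_algebra_ideal p :: ('m \<Rightarrow>\<^sub>0 'k) set) \<longleftrightarrow> a \<in> p"
    using binoid_prime_idealD(1)[OF assms]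
    by (cases "a = binf") (simp_all add: monomial_prime_def single_in_binoid_algebra_ideal_iff)
qed

section \<open>Topology of the two spectra\<close>

lemma binoid_algebra_ideal_mono: "p \<subseteq> q \<Longrightarrow> binoid_algebra_ideal p \<subseteq> binoid_algebra_ideal q"
  by (auto simp: binoid_algebra_ideal_def)

text \<open>An \<open>f\<close> outside \<open>P\<close> is outside every smaller prime. This
  settles the basic open sets, and the property passes to intersections and unions.\<close>

lemma openin_ring_Zariski_generization:
  assumes "openin (ring_Zariski R) V" "P \<in> V" "Q \<in> ring_Spec R" "Q \<subseteq> P"
  shows "Q \<in> V"
proof -
  have "generate_topology_on ((\<lambda>f. {P \<in> ring_Spec R. f \<notin> P}) ` carrier R) V"
    using assms(1) unfolding ring_Zariski_def by (rule openin_topology_generated_by)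
  then have "\<forall>P\<in>V. \<forall>Q\<in>ring_Spec R. Q \<subseteq> P \<longrightarrow> Q \<in> V"
  proof (induction rule: generate_topology_on.induct)
    case (UN K)
    then show ?case by (meson UnionE UnionI)
  qed auto
  then show ?thesis using assms by blast
qed

lemma openin_binoid_Zariski_basic: "openin binoid_Zariski {p \<in> binoid_Spec. a \<notin> p}"
  unfolding binoid_Zariski_def by (rule topology_generated_by_Basis) blast

lemma openin_ring_Zariski_basic: "f \<in> carrier R \<Longrightarrow> openin (ring_Zariski R) {P \<in> ring_Spec R. f \<notin> P}"
  unfolding ring_Zariski_def by (rule topology_generated_by_Basis) blast

lemma binoid_algebra_ideal_in_Spec:
  assumes "cancellative_binoid TYPE('m::binoid)" "torsion_free_up_to_nilpotence TYPE('m)"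
    and "p \<in> (binoid_Spec :: 'm set set)"
  shows "binoid_algebra_ideal p \<in> ring_Spec (binoid_algebra :: ('m \<Rightarrow>\<^sub>0 'k::field) ring)"
  using primeideal_binoid_algebra_ideal[OF assms(1,2)] assms(3)
  by (simp add: ring_Spec_def binoid_Spec_def)

text \<open>The preimage of \<open>D(f)\<close> is the union of the \<open>D(a)\<close> over the
  keys \<open>a\<close> of \<open>f\<close>, because \<open>f\<close> is outside \<K>[p] exactly
  when one of its keys is outside \<open>p\<close>.\<close>

lemma continuous_map_binoid_algebra_ideal:
  assumes "cancellative_binoid TYPE('m::binoid)" "torsion_free_up_to_nilpotence TYPE('m)"
  shows "continuous_map (binoid_Zariski :: 'm set topology)
    (ring_Zariski (binoid_algebra :: ('m \<Rightarrow>\<^sub>0 'k::field) ring)) binoid_algebra_ideal"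
  unfolding ring_Zariski_def
proof (rule continuous_on_generated_topo)
  let ?R = "binoid_algebra :: ('m \<Rightarrow>\<^sub>0 'k) ring"
  have top: "\<Union>((\<lambda>f. {P \<in> ring_Spec ?R. f \<notin> P}) ` carrier ?R) = ring_Spec ?R"
    using topspace_ring_Zariski[of ?R, OF cring_binoid_algebra]
    unfolding ring_Zariski_def topology_generated_by_topspace .
  show "binoid_algebra_ideal ` topspace binoid_Zariski \<subseteq> \<Union>((\<lambda>f. {P \<in> ring_Spec ?R. f \<notin> P}) ` carrier ?R)"
    unfolding top topspace_binoid_Zariski using binoid_algebra_ideal_in_Spec[OF assms] by blast
  fix U assume "U \<in> (\<lambda>f. {P \<in> ring_Spec ?R. f \<notin> P}) ` carrier ?R"
  then obtain f where f: "f \<in> carrier ?R" "U = {P \<in> ring_Spec ?R. f \<notin> P}" by blast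
  have "binoid_algebra_ideal -` U \<inter> topspace binoid_Zariski =
      (\<Union>a\<in>Poly_Mapping.keys f. {p \<in> binoid_Spec. a \<notin> p})"
    using f binoid_algebra_ideal_in_Spec[OF assms, where 'k = 'k]
    by (auto simp: topspace_binoid_Zariski binoid_algebra_ideal_def)
  moreover have "openin binoid_Zariski (\<Union>a\<in>Poly_Mapping.keys f. {p \<in> binoid_Spec. a \<notin> p})"
    by (rule openin_Union) (use openin_binoid_Zariski_basic in blast)
  ultimately show "openin binoid_Zariski (binoid_algebra_ideal -` U \<inter> topspace binoid_Zariski)"
    by simp
qed

lemma sum_notin_binoid_prime_ideal_iff:
  assumes "binoid_prime_ideal q" "finite A"
  shows "\<Sum>A \<notin> q \<longleftrightarrow> A \<inter> q = {}"
  using assms(2)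
proof (induction A rule: finite_induct)
  case empty
  then show ?case using binoid_prime_idealD(4)[OF assms(1)] by simp
next
  case (insert a A)
  have "a + \<Sum>A \<in> q \<longleftrightarrow> a \<in> q \<or> \<Sum>A \<in> q"
    using binoid_prime_idealD(2,3,5)[OF assms(1)] by blast
  then show ?case using insert by auto
qed

text \<open>The witness is the sum of the finitely many generators outside \<open>p\<close>: a prime
  avoiding it avoids each of them and so everything outside \<open>p\<close>. Thus
  \<open>D(f)\<close> is the smallest open neighbourhood of \<open>p\<close>.\<close>

lemma binoid_prime_ideal_minimal_basic_open:
  fixes p :: "'m::binoid set"
  assumes "finitely_generated_binoid TYPE('m)" "binoid_prime_ideal p"
  obtains f where "f \<notin> p" "\<And>q. binoid_prime_ideal q \<Longrightarrow> f \<notin> q \<Longrightarrow> q \<subseteq> p"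
proof -
  obtain S :: "'m set" where S: "finite S" "subbinoid_generated S = UNIV"
    using assms(1) unfolding finitely_generated_binoid_def by blast
  show ?thesis
  proof (rule that[of "\<Sum>(S - p)"])
    show "\<Sum>(S - p) \<notin> p" using sum_notin_binoid_prime_ideal_iff[OF assms(2), of "S - p"] S by auto
    fix q :: "'m set" assume q: "binoid_prime_ideal q" and "\<Sum>(S - p) \<notin> q"
    then have dis: "(S - p) \<inter> q = {}" using sum_notin_binoid_prime_ideal_iff[OF q, of "S - p"] S by auto
    have "a \<notin> p \<longrightarrow> a \<notin> q" if "a \<in> subbinoid_generated S" for a
      using that
    proof induction
      case (add a b)
      then show ?case
        using binoid_prime_idealD(5)[OF q, of a b] binoid_prime_idealD(2)[OF assms(2), of a b]
          binoid_prime_idealD(3)[OF assms(2), of b a] by blast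
    qed (use dis binoid_prime_idealD[OF q] binoid_prime_idealD[OF assms(2)] in auto)
    then show "q \<subseteq> p" using S by auto
  qed
qed

lemma binoid_prime_ideal_nonunits:
  assumes "(0 :: 'm::binoid) \<noteq> binf"
  shows "binoid_prime_ideal {a :: 'm. \<forall>b. a + b \<noteq> 0}"
  unfolding binoid_prime_ideal_def
proof (intro conjI ballI allI impI)
  show "binf \<in> {a :: 'm. \<forall>b. a + b \<noteq> 0}"
    using assms[symmetric] by (simp add: add.commute[of binf] binf_absorbing)
  fix a b :: 'm
  show "a + b \<in> {a. \<forall>b. a + b \<noteq> 0}" if "a \<in> {a. \<forall>b. a + b \<noteq> 0}"
    using that by (simp add: add.assoc)
  show "a + b \<notin> {a. \<forall>b. a + b \<noteq> 0}" if ab: "a \<notin> {a. \<forall>b. a + b \<noteq> 0} \<and> b \<notin> {a. \<forall>b. a + b \<noteq> 0}"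
  proof -
    obtain c d where cd: "a + c = 0" "b + d = 0" using ab by auto
    have "(a + b) + (c + d) = (a + c) + (b + d)" by (simp only: add_ac)
    then have "(a + b) + (c + d) = 0" by (simp only: cd add_0)
    then show ?thesis by blast
  qed
qed simp

text \<open>A unit in \<open>q\<close> would force \<open>0\<close> into \<open>q\<close>. In a
  nonzero binoid the nonunits are thus the largest prime, and every open set containing it is all of
  \<open>Spec M\<close>.\<close>

lemma binoid_prime_ideal_subset_nonunits:
  "binoid_prime_ideal q \<Longrightarrow> q \<subseteq> {a. \<forall>b. a + b \<noteq> 0}"
  unfolding binoid_prime_ideal_def by (intro subsetI CollectI allI) metis

section \<open>Gluing and lifting of sections\<close>

locale abelian_sheaf_on =
  fixes X :: "'x topology" and F :: "('x, 's) presheaf"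
  assumes abelian_sheaf: "abelian_sheaf X F"
begin

lemma comm_group_sections: "openin X U \<Longrightarrow> comm_group (sections F U)"
  using abelian_sheaf by (simp add: abelian_sheaf_def abelian_presheaf_def)

lemma group_sections: "openin X U \<Longrightarrow> group (sections F U)"
  using comm_group_sections by (simp add: comm_group_def)

lemma restr_id: "openin X U \<Longrightarrow> s \<in> carrier (sections F U) \<Longrightarrow> restr F U U s = s"
  using abelian_sheaf by (simp add: abelian_sheaf_def abelian_presheaf_def)

lemma restr_restr:
  "openin X U \<Longrightarrow> openin X V \<Longrightarrow> openin X W \<Longrightarrow> W \<subseteq> V \<Longrightarrow> V \<subseteq> U \<Longrightarrow> s \<in> carrier (sections F U) \<Longrightarrow>
    restr F V W (restr F U V s) = restr F U W s"
  using abelian_sheaf by (simp add: abelian_sheaf_def abelian_presheaf_def)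

lemma group_hom_restr:
  assumes "openin X U" "openin X V" "V \<subseteq> U"
  shows "group_hom (sections F U) (sections F V) (restr F U V)"
  using abelian_sheaf assms group_sections
  by (simp add: abelian_sheaf_def abelian_presheaf_def group_hom_def group_hom_axioms_def)

lemma restr_closed:
  "openin X U \<Longrightarrow> openin X V \<Longrightarrow> V \<subseteq> U \<Longrightarrow> s \<in> carrier (sections F U) \<Longrightarrow>
    restr F U V s \<in> carrier (sections F V)"
  using group_hom.hom_closed[OF group_hom_restr] .

text \<open>A pointwise form of the uniqueness axiom: the open sets on which \<open>s\<close> and
  \<open>t\<close> agree cover \<open>U\<close>.\<close>

lemma sections_eqI:
  assumes "openin X U" "s \<in> carrier (sections F U)" "t \<in> carrier (sections F U)"
    and "\<And>x. x \<in> U \<Longrightarrow> \<exists>V. openin X V \<and> x \<in> V \<and> V \<subseteq> U \<and> restr F U V s = restr F U V t"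
  shows "s = t"
proof -
  let ?\<U> = "{V. openin X V \<and> V \<subseteq> U \<and> restr F U V s = restr F U V t}"
  have U: "\<Union>?\<U> = U" using assms(4) by blast
  have "(\<forall>U\<in>?\<U>. openin X U) \<longrightarrow> (\<forall>s \<in> carrier (sections F (\<Union>?\<U>)). \<forall>t \<in> carrier (sections F (\<Union>?\<U>)).
      (\<forall>V\<in>?\<U>. restr F (\<Union>?\<U>) V s = restr F (\<Union>?\<U>) V t) \<longrightarrow> s = t)"
    using abelian_sheaf unfolding abelian_sheaf_def by blast
  then show ?thesis unfolding U using assms(2,3) by auto
qed

lemma glue:
  assumes "\<And>U. U \<in> \<U> \<Longrightarrow> openin X U" "\<And>U. U \<in> \<U> \<Longrightarrow> s U \<in> carrier (sections F U)"
    and "\<And>U V. U \<in> \<U> \<Longrightarrow> V \<in> \<U> \<Longrightarrow> restr F U (U \<inter> V) (s U) = restr F V (U \<inter> V) (s V)"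
  shows "\<exists>t \<in> carrier (sections F (\<Union>\<U>)). \<forall>U\<in>\<U>. restr F (\<Union>\<U>) U t = s U"
  by (rule abelian_sheaf[unfolded abelian_sheaf_def, THEN conjunct2, THEN spec, THEN mp,
        THEN conjunct2, THEN spec, THEN mp])
    (intro conjI ballI assms; assumption)+

lemma glue_two:
  assumes "openin X U" "openin X V" "s \<in> carrier (sections F U)" "t \<in> carrier (sections F V)"
    and "restr F U (U \<inter> V) s = restr F V (U \<inter> V) t"
  obtains r where "r \<in> carrier (sections F (U \<union> V))" "restr F (U \<union> V) U r = s" "restr F (U \<union> V) V r = t"
proof -
  let ?s = "\<lambda>W. if W = U then s else t"
  \<comment> \<open>If \<open>U = V\<close>, the function \<open>?s\<close> picks \<open>s\<close>
    for both sets, so \<open>t\<close> has to coincide with it.\<close>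
  have eq: "s = t" if "U = V" using assms that restr_id by simp
  have "\<exists>r \<in> carrier (sections F (\<Union>{U, V})). \<forall>W\<in>{U, V}. restr F (\<Union>{U, V}) W r = ?s W"
  proof (rule glue)
    show "openin X W" if "W \<in> {U, V}" for W using that assms by auto
    show "?s W \<in> carrier (sections F W)" if "W \<in> {U, V}" for W using that assms by auto
    show "restr F W (W \<inter> W') (?s W) = restr F W' (W \<inter> W') (?s W')" if "W \<in> {U, V}" "W' \<in> {U, V}" for W W'
      using that assms eq by (auto simp: Int_commute)
  qed
  then obtain r where r: "r \<in> carrier (sections F (\<Union>{U, V}))" "\<And>W. W \<in> {U, V} \<Longrightarrow> restr F (\<Union>{U, V}) W r = ?s W"
    by blast
  show ?thesis
  proof (rule that[of r])
    show "r \<in> carrier (sections F (U \<union> V))" using r(1) by simp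
    show "restr F (U \<union> V) U r = s" using r(2)[of U] by simp
    show "restr F (U \<union> V) V r = t" using r(2)[of V] eq by (auto split: if_splits)
  qed
qed

lemma sections_empty: "s \<in> carrier (sections F {}) \<Longrightarrow> t \<in> carrier (sections F {}) \<Longrightarrow> s = t"
  using sections_eqI[of "{}" s t] by simp

end

locale sheaf_morphism = F: abelian_sheaf_on X F + G: abelian_sheaf_on X G
  for X :: "'x topology" and F :: "('x, 's) presheaf" and G :: "('x, 't) presheaf" +
  fixes \<phi> :: "'x set \<Rightarrow> 's \<Rightarrow> 't"
  assumes sheaf_hom: "sheaf_hom X F G \<phi>"
begin

lemma group_hom_component: "openin X U \<Longrightarrow> group_hom (sections F U) (sections G U) (\<phi> U)"
  using sheaf_hom F.group_sections G.group_sections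
  by (simp add: sheaf_hom_def group_hom_def group_hom_axioms_def)

lemma component_closed:
  "openin X U \<Longrightarrow> s \<in> carrier (sections F U) \<Longrightarrow> \<phi> U s \<in> carrier (sections G U)"
  using group_hom.hom_closed[OF group_hom_component] .

lemma component_restr:
  "openin X U \<Longrightarrow> openin X V \<Longrightarrow> V \<subseteq> U \<Longrightarrow> s \<in> carrier (sections F U) \<Longrightarrow>
    \<phi> V (restr F U V s) = restr G U V (\<phi> U s)"
  using sheaf_hom by (simp add: sheaf_hom_def)

text \<open>Sections of the image sheaf have preimages only locally, but injectivity makes these
  unique, so they agree on overlaps and glue.\<close>

lemma image_of_mono:
  assumes mono: "sheaf_mono X F G \<phi>" and U: "openin X U" and s: "s \<in> sheaf_image X F G \<phi> U"
  obtains r where "r \<in> carrier (sections F U)" "\<phi> U r = s"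
proof -
  define \<U> where "\<U> = {V. openin X V \<and> V \<subseteq> U \<and> restr G U V s \<in> \<phi> V ` carrier (sections F V)}"
  have \<U>_D: "openin X V" "V \<subseteq> U" if "V \<in> \<U>" for V using that by (simp_all add: \<U>_def)
  have UU: "\<Union>\<U> = U" using s unfolding sheaf_image_def \<U>_def by blast
  have sG: "s \<in> carrier (sections G U)" using s by (simp add: sheaf_image_def)
  have "\<forall>V\<in>\<U>. \<exists>r. r \<in> carrier (sections F V) \<and> \<phi> V r = restr G U V s"
    unfolding \<U>_def by (auto simp: image_iff)
  from bchoice[OF this] obtain r where
    "\<forall>V\<in>\<U>. r V \<in> carrier (sections F V) \<and> \<phi> V (r V) = restr G U V s" ..
  then have r: "r V \<in> carrier (sections F V)" "\<phi> V (r V) = restr G U V s" if "V \<in> \<U>" for V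
    using that by blast+
  have restr_r: "\<phi> W (restr F V W (r V)) = restr G U W s" if "V \<in> \<U>" "W \<subseteq> V" "openin X W" for V W
    using that r[OF that(1)] \<U>_D[OF that(1)] U sG by (simp add: component_restr G.restr_restr)
  have "\<exists>q \<in> carrier (sections F (\<Union>\<U>)). \<forall>V\<in>\<U>. restr F (\<Union>\<U>) V q = r V"
  proof (rule F.glue)
    show "openin X V" if "V \<in> \<U>" for V using \<U>_D that by blast
    show "r V \<in> carrier (sections F V)" if "V \<in> \<U>" for V using r that by blast
    fix V W assume V: "V \<in> \<U>" and W: "W \<in> \<U>"
    then have VW: "openin X (V \<inter> W)" using \<U>_D by blast
    then have "inj_on (\<phi> (V \<inter> W)) (carrier (sections F (V \<inter> W)))"
      using mono by (simp add: sheaf_mono_def)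
    moreover have "\<phi> (V \<inter> W) (restr F V (V \<inter> W) (r V)) = \<phi> (V \<inter> W) (restr F W (V \<inter> W) (r W))"
      using restr_r[OF V _ VW] restr_r[OF W _ VW] by simp
    ultimately show "restr F V (V \<inter> W) (r V) = restr F W (V \<inter> W) (r W)"
      using r(1)[OF V] r(1)[OF W] \<U>_D[OF V] \<U>_D[OF W] VW by (auto simp: inj_on_def F.restr_closed)
  qed
  then obtain q where qU: "q \<in> carrier (sections F U)" "\<And>V. V \<in> \<U> \<Longrightarrow> restr F U V q = r V"
    unfolding UU by blast
  have "\<phi> U q = s"
  proof (rule G.sections_eqI[OF U component_closed[OF U qU(1)] sG])
    fix x assume "x \<in> U"
    then obtain V where V: "V \<in> \<U>" "x \<in> V" using UU by blast
    then have "restr G U V (\<phi> U q) = restr G U V s"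
      using component_restr[OF U _ _ qU(1), of V] qU(2)[OF V(1)] r(2)[OF V(1)] \<U>_D[OF V(1)] by simp
    then show "\<exists>V. openin X V \<and> x \<in> V \<and> V \<subseteq> U \<and> restr G U V (\<phi> U q) = restr G U V s"
      using V \<U>_D[OF V(1)] by blast
  qed
  then show ?thesis using that qU by blast
qed

text \<open>Zorn's lemma for partial lifts \<open>(V, w)\<close> of \<open>z\<close>. The sections
  of a chain glue to an upper bound, and \<open>ext\<close> enlarges any lift that misses a point of
  \<open>W\<close>. Every domain contains \<open>V0\<close>, which \<open>ext\<close> may
  use.\<close>

lemma lift_by_local_extension:
  assumes W: "openin X W" and z: "z \<in> carrier (sections G W)"
    and start: "openin X V0" "V0 \<subseteq> W" "w0 \<in> carrier (sections F V0)" "\<phi> V0 w0 = restr G W V0 z"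
    and ext: "\<And>V w y. openin X V \<Longrightarrow> V0 \<subseteq> V \<Longrightarrow> V \<subseteq> W \<Longrightarrow> w \<in> carrier (sections F V) \<Longrightarrow>
      \<phi> V w = restr G W V z \<Longrightarrow> y \<in> W \<Longrightarrow>
      \<exists>N u. openin X N \<and> y \<in> N \<and> N \<subseteq> W \<and> u \<in> carrier (sections F N) \<and> \<phi> N u = restr G W N z \<and>
        restr F V (V \<inter> N) w = restr F N (V \<inter> N) u"
  obtains w where "w \<in> carrier (sections F W)" "\<phi> W w = z"
proof -
  define A where "A = {(V, w). openin X V \<and> V0 \<subseteq> V \<and> V \<subseteq> W \<and> w \<in> carrier (sections F V) \<and>
    \<phi> V w = restr G W V z}"
  define P where "P = (\<lambda>a b. fst a \<subseteq> fst b \<and> restr F (fst b) (fst a) (snd b) = snd a)"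
  have A_D: "openin X V" "V0 \<subseteq> V" "V \<subseteq> W" "w \<in> carrier (sections F V)" "\<phi> V w = restr G W V z"
    if "(V, w) \<in> A" for V w using that by (auto simp: A_def)
  \<comment> \<open>Lifting \<open>z\<close> is a local condition; this is how glued sections are
    recognized as members of \<open>A\<close>.\<close>
  have lift_eqI: "(V, w) \<in> A" if V: "openin X V" "V0 \<subseteq> V" "V \<subseteq> W" "w \<in> carrier (sections F V)"
    and loc: "\<And>x. x \<in> V \<Longrightarrow> \<exists>N. openin X N \<and> x \<in> N \<and> N \<subseteq> V \<and> \<phi> N (restr F V N w) = restr G W N z"
    for V w
  proof -
    have "\<phi> V w = restr G W V z"
    proof (rule G.sections_eqI[OF V(1)])
      show "\<phi> V w \<in> carrier (sections G V)" using V component_closed by blast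
      show "restr G W V z \<in> carrier (sections G V)" using V W z G.restr_closed by blast
      fix x assume "x \<in> V"
      from loc[OF this] show "\<exists>N. openin X N \<and> x \<in> N \<and> N \<subseteq> V \<and>
          restr G V N (\<phi> V w) = restr G V N (restr G W V z)"
        using component_restr[OF V(1) _ _ V(4)] G.restr_restr[OF W V(1) _ _ V(3) z] by metis
    qed
    then show ?thesis using V by (simp add: A_def)
  qed
  have po: "partial_order_on A (relation_of P A)"
  proof (rule partial_order_on_relation_ofI)
    show "P a a" if "a \<in> A" for a using that A_D F.restr_id by (cases a) (auto simp: P_def)
    show "P a c" if "a \<in> A" "b \<in> A" "c \<in> A" "P a b" "P b c" for a b c
      using that F.restr_restr[of "fst c" "fst b" "fst a" "snd c"] A_D
      by (cases a; cases b; cases c) (auto simp: P_def)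
    show "a = b" if "a \<in> A" "b \<in> A" "P a b" "P b a" for a b
      using that F.restr_id A_D by (cases a; cases b) (auto simp: P_def)
  qed
  have ub: "\<exists>u\<in>A. \<forall>a\<in>C. P a u" if C: "C \<in> Chains (relation_of P A)" for C
  proof (cases "C = {}")
    case True
    have "(V0, w0) \<in> A" using start by (simp add: A_def)
    then show ?thesis using True by blast
  next
    case False
    have CA: "C \<subseteq> A" using C unfolding Chains_def relation_of_def by auto
    have cmp: "P a b \<or> P b a" if "a \<in> C" "b \<in> C" for a b
      using C that unfolding Chains_def relation_of_def by auto
    let ?\<U> = "fst ` C"
    \<comment> \<open>Gluing expects one section for each open set, whereas the chain is a set of
      pairs. Comparability makes the choice unique.\<close>
    define s where "s = (\<lambda>V. SOME w. (V, w) \<in> C)"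
    have sC: "(V, s V) \<in> C" if "V \<in> ?\<U>" for V
      using that unfolding s_def by (metis (mono_tags, lifting) imageE prod.collapse someI)
    have s_eq: "s V = w" if "(V, w) \<in> C" for V w
    proof -
      have VC: "(V, s V) \<in> C" by (rule sC) (use that in force)
      have "restr F V V (s V) = s V" "restr F V V w = w"
        using A_D(1,4)[of V] VC that CA by (auto intro: F.restr_id)
      then show ?thesis using cmp[OF VC that] by (auto simp: P_def)
    qed
    have compat: "restr F U (U \<inter> V) (s U) = restr F V (U \<inter> V) (s V)" if "U \<in> ?\<U>" "V \<in> ?\<U>" for U V
    proof -
      have *: "restr F U (U \<inter> V) (s U) = restr F V (U \<inter> V) (s V)"
        if "(U, s U) \<in> C" "(V, s V) \<in> C" "P (U, s U) (V, s V)" for U V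
      proof -
        have "U \<inter> V = U" "restr F V U (s V) = s U" using that by (auto simp: P_def)
        moreover have "restr F U U (s U) = s U" using that A_D(1,4)[of U] CA by (auto intro: F.restr_id)
        ultimately show ?thesis by simp
      qed
      from cmp[OF sC[OF that(1)] sC[OF that(2)]] show ?thesis
      proof
        assume "P (U, s U) (V, s V)" then show ?thesis using * sC that by blast
      next
        assume "P (V, s V) (U, s U)" from *[OF sC sC this] show ?thesis using that by (simp add: Int_commute)
      qed
    qed
    have "\<exists>t \<in> carrier (sections F (\<Union>?\<U>)). \<forall>V\<in>?\<U>. restr F (\<Union>?\<U>) V t = s V"
    proof (rule F.glue[OF _ _ compat])
      show "openin X V" if "V \<in> ?\<U>" for V using sC[OF that] CA A_D(1)[of V "s V"] by blast
      show "s V \<in> carrier (sections F V)" if "V \<in> ?\<U>" for V using sC[OF that] CA A_D(4)[of V "s V"] by blast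
    qed
    then obtain t where t: "t \<in> carrier (sections F (\<Union>?\<U>))" "\<And>V. V \<in> ?\<U> \<Longrightarrow> restr F (\<Union>?\<U>) V t = s V"
      by blast
    have "(\<Union>?\<U>, t) \<in> A"
    proof (rule lift_eqI[OF _ _ _ t(1)])
      show "openin X (\<Union>?\<U>)" by (rule openin_Union) (use sC CA A_D(1) in blast)
      obtain V where V: "V \<in> ?\<U>" using False by blast
      then have "V0 \<subseteq> V" using A_D(2)[of V "s V"] sC[OF V] CA by blast
      then show "V0 \<subseteq> \<Union>?\<U>" using V by (rule order_trans[OF _ Union_upper])
      show "\<Union>?\<U> \<subseteq> W"
      proof (rule Union_least)
        show "V \<subseteq> W" if "V \<in> ?\<U>" for V using A_D(3)[of V "s V"] sC[OF that] CA by blast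
      qed
      fix x assume "x \<in> \<Union>?\<U>"
      then obtain V where V: "V \<in> ?\<U>" "x \<in> V" by blast
      have VA: "(V, s V) \<in> A" using sC[OF V(1)] CA by blast
      show "\<exists>N. openin X N \<and> x \<in> N \<and> N \<subseteq> \<Union>?\<U> \<and> \<phi> N (restr F (\<Union>?\<U>) N t) = restr G W N z"
        using V A_D[OF VA] t(2)[OF V(1)] by (intro exI[of _ V]) auto
    qed
    moreover have "P a (\<Union>?\<U>, t)" if "a \<in> C" for a
    proof -
      have "fst a \<in> ?\<U>" using that by blast
      then show ?thesis using t(2) s_eq[of "fst a" "snd a"] that by (auto simp: P_def)
    qed
    ultimately show ?thesis by blast
  qed
  obtain V w where Vw: "(V, w) \<in> A" and max: "\<And>a. a \<in> A \<Longrightarrow> P (V, w) a \<Longrightarrow> a = (V, w)"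
    using predicate_Zorn[OF po ub] by auto
  note V = A_D[OF Vw]
  have "W \<subseteq> V"
  proof
    fix y assume "y \<in> W"
    then obtain N u where N: "openin X N" "y \<in> N" "N \<subseteq> W" "u \<in> carrier (sections F N)"
      "\<phi> N u = restr G W N z" "restr F V (V \<inter> N) w = restr F N (V \<inter> N) u"
      using ext[OF V] by blast
    obtain t where t: "t \<in> carrier (sections F (V \<union> N))" "restr F (V \<union> N) V t = w" "restr F (V \<union> N) N t = u"
      using F.glue_two[OF V(1) N(1) V(4) N(4,6)] by blast
    have "(V \<union> N, t) \<in> A"
    proof (rule lift_eqI[OF _ _ _ t(1)])
      fix x assume "x \<in> V \<union> N"
      then consider "x \<in> V" | "x \<in> N" by blast
      then show "\<exists>Q. openin X Q \<and> x \<in> Q \<and> Q \<subseteq> V \<union> N \<and> \<phi> Q (restr F (V \<union> N) Q t) = restr G W Q z"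
      proof cases
        case 1 then show ?thesis using V t by (intro exI[of _ V]) auto
      next
        case 2 then show ?thesis using N t by (intro exI[of _ N]) auto
      qed
    qed (use V N in auto)
    then have "(V \<union> N, t) = (V, w)" by (rule max) (use t in \<open>auto simp: P_def\<close>)
    then show "y \<in> V" using N by auto
  qed
  then have "V = W" using V by blast
  then show ?thesis using that V G.restr_id[OF W z] by simp
qed

end

section \<open>Vanishing of cohomology\<close>

lemma (in group) trivial_group_FactGroup_self: "trivial_group (G Mod carrier G)"
proof -
  have self: "carrier G #> x = carrier G" "x <# carrier G = carrier G" if "x \<in> carrier G" for x
    using that coset_join2 coset_join3 subgroup_self by blast+
  have "carrier G \<lhd> G" by (rule normalI[OF subgroup_self]) (simp add: self)
  then have "group (G Mod carrier G)" by (rule normal.factorgroup_is_group)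
  moreover have "rcosets (carrier G) = {carrier G}"
    unfolding RCOSETS_def using self(1) one_closed by blast
  ultimately show ?thesis by (simp add: trivial_group_def FactGroup_def)
qed

section \<open>Flasque sheaves and centered neighbourhoods\<close>

definition flasque_sheaf :: "'x topology \<Rightarrow> ('x, 's) presheaf \<Rightarrow> bool" where
  "flasque_sheaf X F \<longleftrightarrow> abelian_sheaf X F \<and>
     (\<forall>U. openin X U \<longrightarrow> (\<forall>s \<in> carrier (sections F U).
        \<exists>t \<in> carrier (sections F (topspace X)). restr F (topspace X) U t = s))"

lemma flasque_sheaf_extend:
  assumes "flasque_sheaf X F" "openin X U" "openin X V" "V \<subseteq> U" "s \<in> carrier (sections F V)"
  obtains t where "t \<in> carrier (sections F U)" "restr F U V t = s"
proof -
  interpret abelian_sheaf_on X F using assms(1) by unfold_locales (simp add: flasque_sheaf_def)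
  obtain t where "t \<in> carrier (sections F (topspace X))" "restr F (topspace X) V t = s"
    using assms unfolding flasque_sheaf_def by blast
  then show ?thesis
    using assms openin_subset[OF assms(2)]
    by (intro that[of "restr F (topspace X) U t"]) (simp_all add: restr_closed restr_restr)
qed

text \<open>Applied with \<open>c P = \<K>[r P]\<close>, for \<open>r\<close> as above and \<open>e\<close> in the image of \<open>i\<close>.\<close>

definition centered_at :: "'x topology \<Rightarrow> ('x \<Rightarrow> 'x) \<Rightarrow> 'x \<Rightarrow> 'x set \<Rightarrow> bool" where
  "centered_at X c e W \<longleftrightarrow> openin X W \<and> e \<in> W \<and> (\<forall>V y. openin X V \<and> e \<in> V \<and> y \<in> W \<longrightarrow> c y \<in> V)"

lemma centered_at_subset:
  "centered_at X c e W \<Longrightarrow> openin X V \<Longrightarrow> e \<in> V \<Longrightarrow> V \<subseteq> W \<Longrightarrow> centered_at X c e V"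
  unfolding centered_at_def by blast

text \<open>The situation of the theorem in general form: a flasque resolution of \<open>G\<close>
  on a space where each point \<open>y\<close> has a center \<open>c y\<close> lying in all open
  neighbourhoods of \<open>y\<close>. The property of \<open>i\<^sub>*F\<close> that starts the
  induction on degrees is \<open>extend_G\<close>.\<close>

locale centered_resolution =
  fixes X :: "'x topology" and G :: "('x, 's) presheaf" and \<epsilon> :: "'x set \<Rightarrow> 's \<Rightarrow> 't"
    and I :: "nat \<Rightarrow> ('x, 't) presheaf" and d :: "nat \<Rightarrow> 'x set \<Rightarrow> 't \<Rightarrow> 't" and c :: "'x \<Rightarrow> 'x"
  assumes sheaf_G: "abelian_sheaf X G"
    and flasque_I: "flasque_sheaf X (I n)"
    and hom_d: "sheaf_hom X (I n) (I (Suc n)) (d n)"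
    and mono_\<epsilon>: "sheaf_mono X G (I 0) \<epsilon>"
    and exact_0: "sheaf_exact X G (I 0) (I 1) \<epsilon> (d 0)"
    and exact_Suc: "sheaf_exact X (I n) (I (Suc n)) (I (Suc (Suc n))) (d n) (d (Suc n))"
    and center_mem: "openin X V \<Longrightarrow> y \<in> V \<Longrightarrow> c y \<in> V"
    and centered_nbhd: "y \<in> topspace X \<Longrightarrow> \<exists>N. y \<in> N \<and> centered_at X c (c y) N"
    and extend_G: "centered_at X c e W \<Longrightarrow> openin X V \<Longrightarrow> V \<subseteq> W \<Longrightarrow> e \<in> V \<Longrightarrow>
      s \<in> carrier (sections G V) \<Longrightarrow> \<exists>t \<in> carrier (sections G W). restr G W V t = s"
begin

sublocale G: abelian_sheaf_on X G
  by unfold_locales (rule sheaf_G)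

sublocale I: abelian_sheaf_on X "I n" for n
  by unfold_locales (use flasque_I[of n] in \<open>simp add: flasque_sheaf_def\<close>)

sublocale d: sheaf_morphism X "I n" "I (Suc n)" "d n" for n
  by unfold_locales (rule hom_d)

sublocale \<epsilon>: sheaf_morphism X G "I 0" \<epsilon>
  by unfold_locales (use mono_\<epsilon> in \<open>simp add: sheaf_mono_def\<close>)

abbreviation cocycles :: "nat \<Rightarrow> 'x set \<Rightarrow> 't set" where
  "cocycles n U \<equiv> sheaf_kernel (I n) (I (Suc n)) (d n) U"

lemma cocycles_iff:
  "s \<in> cocycles n U \<longleftrightarrow> s \<in> carrier (sections (I n) U) \<and> d n U s = \<one>\<^bsub>sections (I (Suc n)) U\<^esub>"
  by (simp add: sheaf_kernel_def kernel_def)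

text \<open>A global image is a local one, with \<open>U\<close> as the neighbourhood of each point,
  so exactness gives the relation \<open>d d = 0\<close>.\<close>

lemma image_cocycle:
  assumes U: "openin X U" and s: "s \<in> carrier (sections (I n) U)"
  shows "d n U s \<in> cocycles (Suc n) U"
proof -
  have "d n U s \<in> sheaf_image X (I n) (I (Suc n)) (d n) U"
    unfolding sheaf_image_def
  proof (intro CollectI conjI ballI)
    show "d n U s \<in> carrier (sections (I (Suc n)) U)" using U s by (rule d.component_closed)
    show "\<exists>V. openin X V \<and> x \<in> V \<and> V \<subseteq> U \<and> restr (I (Suc n)) U V (d n U s) \<in> d n V ` carrier (sections (I n) V)"
      if "x \<in> U" for x
      using that U s I.restr_id d.component_closed by (intro exI[of _ U]) auto
  qed
  then show ?thesis using exact_Suc[of n] U unfolding sheaf_exact_def by blast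
qed

text \<open>In degree 0 a cocycle is a section of \<open>G\<close> by exactness, and
  \<open>extend_G\<close> applies. In positive degree it is by \<open>surj\<close> a coboundary over
  \<open>V\<close>, which is again centered at \<open>e\<close>, and its primitive extends because
  \<open>I m\<close> is flasque.\<close>

lemma cocycle_extend:
  assumes surj: "\<And>m e W z. n = Suc m \<Longrightarrow> centered_at X c e W \<Longrightarrow> z \<in> cocycles n W \<Longrightarrow>
      \<exists>w \<in> carrier (sections (I m) W). d m W w = z"
    and W: "centered_at X c e W" and V: "openin X V" "V \<subseteq> W" "e \<in> V" and s: "s \<in> cocycles n V"
  shows "\<exists>t \<in> cocycles n W. restr (I n) W V t = s"
proof -
  have oW: "openin X W" using W by (simp add: centered_at_def)
  show ?thesis
  proof (cases n)
    case 0
    have eq: "sheaf_image X G (I 0) \<epsilon> U = cocycles 0 U" if "openin X U" for U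
      using exact_0 that by (simp add: sheaf_exact_def)
    obtain g where g: "g \<in> carrier (sections G V)" "\<epsilon> V g = s"
      using \<epsilon>.image_of_mono[OF mono_\<epsilon> V(1)] s eq[OF V(1)] 0 by blast
    obtain h where h: "h \<in> carrier (sections G W)" "restr G W V h = g"
      using extend_G[OF W V g(1)] by blast
    have "\<epsilon> W h \<in> sheaf_image X G (I 0) \<epsilon> W"
      unfolding sheaf_image_def
    proof (intro CollectI conjI ballI)
      show "\<epsilon> W h \<in> carrier (sections (I 0) W)" using oW h(1) by (rule \<epsilon>.component_closed)
      show "\<exists>V. openin X V \<and> x \<in> V \<and> V \<subseteq> W \<and> restr (I 0) W V (\<epsilon> W h) \<in> \<epsilon> V ` carrier (sections G V)"
        if "x \<in> W" for x
        using that oW h I.restr_id \<epsilon>.component_closed by (intro exI[of _ W]) auto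
    qed
    moreover have "restr (I 0) W V (\<epsilon> W h) = s"
      using \<epsilon>.component_restr[OF oW V(1,2) h(1)] h g by simp
    ultimately show ?thesis using eq[OF oW] 0 by blast
  next
    case (Suc m)
    obtain u where u: "u \<in> carrier (sections (I m) V)" "d m V u = s"
      using surj[OF Suc centered_at_subset[OF W V(1,3,2)] s] by blast
    obtain v where v: "v \<in> carrier (sections (I m) W)" "restr (I m) W V v = u"
      using flasque_sheaf_extend[OF flasque_I oW V(1,2) u(1)] by blast
    have "restr (I n) W V (d m W v) = s"
      using d.component_restr[OF oW V(1,2) v(1)] v u Suc by simp
    moreover have "d m W v \<in> cocycles n W" using image_cocycle[OF oW v(1)] Suc by simp
    ultimately show ?thesis by blast
  qed
qed

text \<open>Exactness gives a primitive near \<open>e\<close>, which is then spread over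
  \<open>W\<close>. On an overlap two primitives differ by a cocycle of degree \<open>n\<close>, and
  the extension of this cocycle corrects the new primitive to match the old one.\<close>

lemma cocycle_lift_step:
  assumes ext: "\<And>e W V s. centered_at X c e W \<Longrightarrow> openin X V \<Longrightarrow> V \<subseteq> W \<Longrightarrow> e \<in> V \<Longrightarrow>
      s \<in> cocycles n V \<Longrightarrow> \<exists>t \<in> cocycles n W. restr (I n) W V t = s"
    and W: "centered_at X c e W" and z: "z \<in> cocycles (Suc n) W"
  shows "\<exists>w \<in> carrier (sections (I n) W). d n W w = z"
proof -
  have oW: "openin X W" and eW: "e \<in> W" using W by (simp_all add: centered_at_def)
  have zI: "z \<in> carrier (sections (I (Suc n)) W)" using z by (simp add: cocycles_iff)
  have img: "z \<in> sheaf_image X (I n) (I (Suc n)) (d n) W"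
    using exact_Suc[of n] oW z unfolding sheaf_exact_def by blast
  have loc: "\<exists>V u. openin X V \<and> x \<in> V \<and> V \<subseteq> W \<and> u \<in> carrier (sections (I n) V) \<and>
      d n V u = restr (I (Suc n)) W V z" if "x \<in> W" for x
  proof -
    have "\<exists>V. openin X V \<and> x \<in> V \<and> V \<subseteq> W \<and> restr (I (Suc n)) W V z \<in> d n V ` carrier (sections (I n) V)"
      using img that by (simp add: sheaf_image_def)
    then obtain V where V: "openin X V" "x \<in> V" "V \<subseteq> W"
      and "restr (I (Suc n)) W V z \<in> d n V ` carrier (sections (I n) V)" by blast
    then obtain u where "u \<in> carrier (sections (I n) V)" "d n V u = restr (I (Suc n)) W V z"
      by (metis imageE)
    then show ?thesis using V by blast
  qed
  obtain V0 w0 where V0: "openin X V0" "e \<in> V0" "V0 \<subseteq> W" "w0 \<in> carrier (sections (I n) V0)"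
    "d n V0 w0 = restr (I (Suc n)) W V0 z" using loc[OF eW] by blast
  have step: "\<exists>N u. openin X N \<and> y \<in> N \<and> N \<subseteq> W \<and> u \<in> carrier (sections (I n) N) \<and>
      d n N u = restr (I (Suc n)) W N z \<and> restr (I n) V (V \<inter> N) w = restr (I n) N (V \<inter> N) u"
    if V: "openin X V" "V0 \<subseteq> V" "V \<subseteq> W" and w: "w \<in> carrier (sections (I n) V)"
      "d n V w = restr (I (Suc n)) W V z" and y: "y \<in> W" for V w y
  proof -
    obtain N1 u1 where N1: "openin X N1" "y \<in> N1" "N1 \<subseteq> W" "u1 \<in> carrier (sections (I n) N1)"
      "d n N1 u1 = restr (I (Suc n)) W N1 z" using loc[OF y] by blast
    have "y \<in> topspace X" using y oW openin_subset by blast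
    then obtain N2 where N2: "y \<in> N2" "centered_at X c (c y) N2" using centered_nbhd by blast
    \<comment> \<open>\<open>N1\<close> carries a primitive and \<open>N2\<close> is centered at
      \<open>c y\<close>; the intersection has both properties.\<close>
    define N where "N = N1 \<inter> N2"
    have oN: "openin X N" and yN: "y \<in> N" and NW: "N \<subseteq> W" and NN1: "N \<subseteq> N1"
      using N1 N2 by (auto simp: N_def centered_at_def)
    have cN: "centered_at X c (c y) N"
      by (rule centered_at_subset[OF N2(2) oN center_mem[OF oN yN]]) (simp add: N_def)
    define D where "D = V \<inter> N"
    have oD: "openin X D" and DV: "D \<subseteq> V" and DN: "D \<subseteq> N" and DW: "D \<subseteq> W"
      using V oN by (auto simp: D_def)
    \<comment> \<open>\<open>V\<close> contains \<open>e\<close> through \<open>V0\<close>, hence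
      the center of every point of \<open>W\<close>. The overlap \<open>D\<close> is therefore a
      neighbourhood of \<open>c y\<close>, as \<open>ext\<close> demands.\<close>
    have "e \<in> V" using V V0 by blast
    then have "c y \<in> V" using W V(1) y unfolding centered_at_def by blast
    then have cD: "c y \<in> D" using center_mem[OF oN yN] by (simp add: D_def)
    define u where "u = restr (I n) N1 N u1"
    have u: "u \<in> carrier (sections (I n) N)" "d n N u = restr (I (Suc n)) W N z"
      using I.restr_closed[OF N1(1) oN NN1 N1(4)] d.component_restr[OF N1(1) oN NN1 N1(4)]
        I.restr_restr[OF oW N1(1) oN NN1 N1(3) zI] N1(5)
      by (simp_all add: u_def)
    define w' u' where "w' = restr (I n) V D w" and "u' = restr (I n) N D u"
    have w': "w' \<in> carrier (sections (I n) D)" "d n D w' = restr (I (Suc n)) W D z"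
      using I.restr_closed[OF V(1) oD DV w(1)] d.component_restr[OF V(1) oD DV w(1)]
        I.restr_restr[OF oW V(1) oD DV V(3) zI] w(2) by (simp_all add: w'_def)
    have u': "u' \<in> carrier (sections (I n) D)" "d n D u' = restr (I (Suc n)) W D z"
      using I.restr_closed[OF oN oD DN u(1)] d.component_restr[OF oN oD DN u(1)]
        I.restr_restr[OF oW oN oD DN NW zI] u(2) by (simp_all add: u'_def)
    interpret D: comm_group "sections (I n) D" by (rule I.comm_group_sections[OF oD])
    interpret dD: group_hom "sections (I n) D" "sections (I (Suc n)) D" "d n D"
      by (rule d.group_hom_component[OF oD])
    let ?\<delta> = "w' \<otimes>\<^bsub>sections (I n) D\<^esub> inv\<^bsub>sections (I n) D\<^esub> u'"
    have "?\<delta> \<in> cocycles n D" using w' u' I.restr_closed[OF oW oD DW zI] by (simp add: cocycles_iff)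
    then obtain t where t: "t \<in> cocycles n N" "restr (I n) N D t = ?\<delta>"
      using ext[OF cN oD DN cD] by blast
    have tI: "t \<in> carrier (sections (I n) N)" using t by (simp add: cocycles_iff)
    interpret N: comm_group "sections (I n) N" by (rule I.comm_group_sections[OF oN])
    interpret dN: group_hom "sections (I n) N" "sections (I (Suc n)) N" "d n N"
      by (rule d.group_hom_component[OF oN])
    interpret rN: group_hom "sections (I n) N" "sections (I n) D" "restr (I n) N D"
      by (rule I.group_hom_restr[OF oN oD DN])
    \<comment> \<open>Multiplying by the cocycle \<open>t\<close> does not change the image under
      \<open>d\<close>, while over \<open>D\<close> it turns \<open>u'\<close> into
      \<open>w'\<close>.\<close>
    let ?v = "t \<otimes>\<^bsub>sections (I n) N\<^esub> u"
    have "d n N ?v = restr (I (Suc n)) W N z"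
      using t(1) tI u I.restr_closed[OF oW oN NW zI] by (simp add: cocycles_iff)
    moreover have "restr (I n) N D ?v = w'"
      using t(2) tI u w' u' by (simp add: u'_def[symmetric] D.m_assoc)
    moreover have "?v \<in> carrier (sections (I n) N)" using tI u by simp
    ultimately show ?thesis using oN yN NW
      by (intro exI[of _ N] exI[of _ ?v] conjI) (simp_all add: D_def w'_def)
  qed
  obtain w where "w \<in> carrier (sections (I n) W)" "d n W w = z"
    using d.lift_by_local_extension[OF oW zI V0(1,3,4,5) step] by blast
  then show ?thesis by blast
qed

text \<open>Primitives of \<open>n\<close>-cocycles allow \<open>n\<close>-cocycles to be extended,
  and this yields primitives of cocycles of degree \<open>n + 1\<close>. The center and the set must
  vary, since extension uses primitives over smaller sets.\<close>

lemma cocycle_lift: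
  "centered_at X c e W \<Longrightarrow> z \<in> cocycles (Suc n) W \<Longrightarrow> \<exists>w \<in> carrier (sections (I n) W). d n W w = z"
proof (induction n arbitrary: e W z)
  case 0
  show ?case by (rule cocycle_lift_step[OF cocycle_extend 0]) simp_all
next
  case (Suc n)
  show ?case by (rule cocycle_lift_step[OF cocycle_extend Suc.prems]) (use Suc.IH in auto)
qed

text \<open>Cocycles and coboundaries coincide, so the cohomology is a group modulo itself.\<close>

lemma trivial_cohomology:
  assumes "\<And>z. z \<in> cocycles (Suc n) (topspace X) \<Longrightarrow>
      \<exists>w \<in> carrier (sections (I n) (topspace X)). d n (topspace X) w = z"
  shows "trivial_group (sheaf_cohomology X I d (Suc n))"
proof -
  let ?T = "topspace X"
  let ?H = "(sections (I (Suc n)) ?T)\<lparr>carrier := global_cocycles X I d (Suc n)\<rparr>"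
  interpret dT: group_hom "sections (I (Suc n)) ?T" "sections (I (Suc (Suc n))) ?T" "d (Suc n) ?T"
    by (rule d.group_hom_component) simp
  have cocycles: "global_cocycles X I d (Suc n) = cocycles (Suc n) ?T"
    by (simp add: global_cocycles_def sheaf_kernel_def)
  have "group ?H"
    unfolding global_cocycles_def by (rule subgroup.subgroup_is_group[OF dT.subgroup_kernel I.group_sections[OF openin_topspace]])
  then interpret H: group ?H .
  have "global_coboundaries X I d (Suc n) = carrier ?H"
    using assms image_cocycle[of ?T _ n] by (auto simp: cocycles global_coboundaries_def)
  then have eq: "sheaf_cohomology X I d (Suc n) = ?H Mod carrier ?H"
    by (simp add: sheaf_cohomology_def)
  show ?thesis unfolding eq by (rule H.trivial_group_FactGroup_self)
qed

end

section \<open>Injective sheaves are flasque\<close>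

text \<open>
  The extension by zero of the constant sheaf \<open>\<int>\<close> on \<open>U\<close>. Its homomorphisms to a sheaf correspond to
  the sections of that sheaf over \<open>U\<close>, so lifting along \<open>\<int>\<^sub>U \<rightarrow> \<int>\<^sub>X\<close> extends sections from \<open>U\<close> to \<open>X\<close>.
\<close>

definition integer_sheaf :: "'x topology \<Rightarrow> 'x set \<Rightarrow> ('x, 'x \<Rightarrow> int) presheaf" where
  "integer_sheaf X U =
     \<lparr>sections = (\<lambda>V. \<lparr>carrier = {f. (\<forall>x. f x \<noteq> 0 \<longrightarrow> x \<in> V \<and> x \<in> U) \<and>
          (\<forall>x\<in>V. \<exists>N. openin X N \<and> x \<in> N \<and> N \<subseteq> V \<and> (\<forall>y\<in>N. f y = f x))},
        mult = (\<lambda>f g x. f x + g x), one = (\<lambda>x. 0)\<rparr>),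
      restr = (\<lambda>V W f x. if x \<in> W then f x else 0)\<rparr>"

lemma integer_sheaf_carrier:
  "f \<in> carrier (sections (integer_sheaf X U) V) \<longleftrightarrow> (\<forall>x. f x \<noteq> 0 \<longrightarrow> x \<in> V \<and> x \<in> U) \<and>
     (\<forall>x\<in>V. \<exists>N. openin X N \<and> x \<in> N \<and> N \<subseteq> V \<and> (\<forall>y\<in>N. f y = f x))"
  by (simp add: integer_sheaf_def)

lemma integer_sheaf_mult: "f \<otimes>\<^bsub>sections (integer_sheaf X U) V\<^esub> g = (\<lambda>x. f x + g x)"
  and integer_sheaf_one: "\<one>\<^bsub>sections (integer_sheaf X U) V\<^esub> = (\<lambda>x. 0)"
  and integer_sheaf_restr: "restr (integer_sheaf X U) V W f = (\<lambda>x. if x \<in> W then f x else 0)"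
  by (simp_all add: integer_sheaf_def)

lemma integer_sheaf_mult_closed:
  assumes f: "f \<in> carrier (sections (integer_sheaf X U) V)" and g: "g \<in> carrier (sections (integer_sheaf X U) V)"
  shows "(\<lambda>x. f x + g x) \<in> carrier (sections (integer_sheaf X U) V)"
  unfolding integer_sheaf_carrier
proof (intro conjI ballI allI impI)
  fix x assume "f x + g x \<noteq> 0"
  then have "f x \<noteq> 0 \<or> g x \<noteq> 0" by auto
  then show "x \<in> V" "x \<in> U" using f g unfolding integer_sheaf_carrier by blast+
next
  fix x assume x: "x \<in> V"
  obtain N where N: "openin X N" "x \<in> N" "N \<subseteq> V" "\<forall>y\<in>N. f y = f x"
    using f x unfolding integer_sheaf_carrier by blast
  obtain N' where N': "openin X N'" "x \<in> N'" "N' \<subseteq> V" "\<forall>y\<in>N'. g y = g x"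
    using g x unfolding integer_sheaf_carrier by blast
  have "\<forall>y\<in>N \<inter> N'. f y + g y = f x + g x" using N(4) N'(4) by (metis IntE)
  then show "\<exists>N. openin X N \<and> x \<in> N \<and> N \<subseteq> V \<and> (\<forall>y\<in>N. f y + g y = f x + g x)"
    using N(1-3) N'(1-3) by blast
qed

lemma integer_sheaf_restr_closed:
  assumes f: "f \<in> carrier (sections (integer_sheaf X U) V)" and W: "openin X W" "W \<subseteq> V"
  shows "(\<lambda>x. if x \<in> W then f x else 0) \<in> carrier (sections (integer_sheaf X U) W)"
  unfolding integer_sheaf_carrier
proof (intro conjI ballI allI impI)
  fix x assume "(if x \<in> W then f x else 0) \<noteq> 0"
  then show "x \<in> W" "x \<in> U" using f unfolding integer_sheaf_carrier by (auto split: if_splits)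
next
  fix x assume x: "x \<in> W"
  then obtain N where N: "openin X N" "x \<in> N" "N \<subseteq> V" "\<forall>y\<in>N. f y = f x"
    using f W unfolding integer_sheaf_carrier by blast
  then have "\<forall>y\<in>N \<inter> W. (if y \<in> W then f y else 0) = (if x \<in> W then f x else 0)" using x by (metis IntE)
  then show "\<exists>N. openin X N \<and> x \<in> N \<and> N \<subseteq> W \<and>
      (\<forall>y\<in>N. (if y \<in> W then f y else 0) = (if x \<in> W then f x else 0))"
    using x W N(1,2) by blast
qed

lemma comm_group_integer_sheaf:
  assumes "openin X V"
  shows "comm_group (sections (integer_sheaf X U) V)"
proof (rule comm_groupI, goal_cases)
  case (1 f g)
  then show ?case using integer_sheaf_mult_closed by (simp add: integer_sheaf_mult)
next
  case 2
  then show ?case using assms by (auto simp: integer_sheaf_one integer_sheaf_carrier)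
next
  case (6 f)
  have "(\<lambda>x. - f x) \<in> carrier (sections (integer_sheaf X U) V)"
    using 6 by (simp add: integer_sheaf_carrier)
  then show ?case
    by (rule bexI[rotated]) (simp add: integer_sheaf_mult integer_sheaf_one)
qed (simp_all add: integer_sheaf_mult integer_sheaf_one algebra_simps)

text \<open>Support in \<open>U\<close> and local constancy are local conditions, so compatible
  functions glue to a section.\<close>

lemma abelian_sheaf_integer_sheaf: "abelian_sheaf X (integer_sheaf X U)"
proof -
  let ?Z = "integer_sheaf X U"
  have "abelian_presheaf X ?Z"
    unfolding abelian_presheaf_def
  proof (intro conjI allI impI ballI)
    show "comm_group (sections ?Z V)" if "openin X V" for V using comm_group_integer_sheaf that .
    show "restr ?Z V W \<in> hom (sections ?Z V) (sections ?Z W)"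
      if "openin X V \<and> openin X W \<and> W \<subseteq> V" for V W
      using that by (auto intro!: homI ext simp: integer_sheaf_restr integer_sheaf_restr_closed integer_sheaf_mult)
    show "restr ?Z V V f = f" if "f \<in> carrier (sections ?Z V)" for V f
      using that by (auto simp: integer_sheaf_restr integer_sheaf_carrier fun_eq_iff)
    show "restr ?Z V W (restr ?Z V' V f) = restr ?Z V' W f"
      if "openin X V' \<and> openin X V \<and> openin X W \<and> W \<subseteq> V \<and> V \<subseteq> V'" for V' V W f
      using that by (auto simp: integer_sheaf_restr fun_eq_iff)
  qed
  moreover have "f = g"
    if f: "f \<in> carrier (sections ?Z (\<Union>\<U>))" and g: "g \<in> carrier (sections ?Z (\<Union>\<U>))"
      and eq: "\<forall>V\<in>\<U>. restr ?Z (\<Union>\<U>) V f = restr ?Z (\<Union>\<U>) V g" for \<U> f g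
  proof
    fix x
    show "f x = g x"
    proof (cases "x \<in> \<Union>\<U>")
      case True
      then obtain V where V: "V \<in> \<U>" "x \<in> V" by blast
      then have "restr ?Z (\<Union>\<U>) V f x = restr ?Z (\<Union>\<U>) V g x" using eq by simp
      then show ?thesis using V by (simp add: integer_sheaf_restr)
    next
      case False
      then show ?thesis using f g unfolding integer_sheaf_carrier by metis
    qed
  qed
  moreover have "\<exists>t \<in> carrier (sections ?Z (\<Union>\<U>)). \<forall>V\<in>\<U>. restr ?Z (\<Union>\<U>) V t = s V"
    if op: "\<forall>V\<in>\<U>. openin X V" and s: "\<forall>V\<in>\<U>. s V \<in> carrier (sections ?Z V)"
      and compat: "\<forall>V\<in>\<U>. \<forall>W\<in>\<U>. restr ?Z V (V \<inter> W) (s V) = restr ?Z W (V \<inter> W) (s W)" for \<U> s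
  proof -
    \<comment> \<open>By compatibility the chosen member is immaterial. The value 0 off the union is
      forced, since sections are total functions vanishing outside their domain.\<close>
    define t where "t = (\<lambda>x. if x \<in> \<Union>\<U> then s (SOME V. V \<in> \<U> \<and> x \<in> V) x else 0)"
    have s_eq: "s V x = s W x" if "V \<in> \<U>" "W \<in> \<U>" "x \<in> V" "x \<in> W" for V W x
    proof -
      have "restr ?Z V (V \<inter> W) (s V) x = restr ?Z W (V \<inter> W) (s W) x"
        by (rule fun_cong[OF bspec[OF bspec[OF compat that(1)] that(2)]])
      then show ?thesis using that by (simp add: integer_sheaf_restr)
    qed
    have t_eq: "t x = s V x" if "V \<in> \<U>" "x \<in> V" for V x
    proof -
      have "(SOME V. V \<in> \<U> \<and> x \<in> V) \<in> \<U> \<and> x \<in> (SOME V. V \<in> \<U> \<and> x \<in> V)"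
        using that by (intro someI[of "\<lambda>V. V \<in> \<U> \<and> x \<in> V" V]) simp
      then have "s (SOME V. V \<in> \<U> \<and> x \<in> V) x = s V x" using s_eq that by blast
      moreover have "x \<in> \<Union>\<U>" using that by blast
      ultimately show ?thesis by (simp only: t_def if_True)
    qed
    have restr_t: "restr ?Z (\<Union>\<U>) V t = s V" if V: "V \<in> \<U>" for V
    proof
      fix x
      show "restr ?Z (\<Union>\<U>) V t x = s V x"
        using t_eq[OF V] bspec[OF s V] by (auto simp: integer_sheaf_restr integer_sheaf_carrier)
    qed
    have "t \<in> carrier (sections ?Z (\<Union>\<U>))"
      unfolding integer_sheaf_carrier
    proof (intro conjI ballI allI impI)
      fix x assume nz: "t x \<noteq> 0"
      then show x: "x \<in> \<Union>\<U>" unfolding t_def by meson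
      then obtain V where V: "V \<in> \<U>" "x \<in> V" by blast
      then have "s V x \<noteq> 0" using nz t_eq by simp
      then show "x \<in> U" using bspec[OF s V(1)] by (simp add: integer_sheaf_carrier)
    next
      fix x assume "x \<in> \<Union>\<U>"
      then obtain V where V: "V \<in> \<U>" "x \<in> V" by blast
      then obtain N where N: "openin X N" "x \<in> N" "N \<subseteq> V" "\<forall>y\<in>N. s V y = s V x"
        using bspec[OF s V(1)] unfolding integer_sheaf_carrier by blast
      have "\<forall>y\<in>N. t y = t x" using N(2-4) t_eq[OF V(1)] by (metis subsetD)
      then show "\<exists>N. openin X N \<and> x \<in> N \<and> N \<subseteq> \<Union>\<U> \<and> (\<forall>y\<in>N. t y = t x)"
        using N V by blast
    qed
    then show ?thesis using restr_t by blast
  qed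
  ultimately show ?thesis
    unfolding abelian_sheaf_def by (intro conjI allI impI ballI) (blast | simp)+
qed

section \<open>The morphism from the integer sheaf determined by a section\<close>

context abelian_sheaf_on
begin

text \<open>Over \<open>N\<close>, where \<open>f\<close> has constant value \<open>n\<close>, this
  says that \<open>t\<close> is the \<open>n\<close>-th power of \<open>s\<close>. The separate case
  \<open>n = 0\<close> covers sets \<open>N\<close> that leave \<open>U\<close>, to which
  \<open>s\<close> cannot be restricted.\<close>

definition locally_power :: "'x set \<Rightarrow> 's \<Rightarrow> 'x set \<Rightarrow> ('x \<Rightarrow> int) \<Rightarrow> 's \<Rightarrow> bool" where
  "locally_power U s N f t \<longleftrightarrow> (\<exists>n. (\<forall>x\<in>N. f x = n) \<and>
     (n = 0 \<and> t = \<one>\<^bsub>sections F N\<^esub> \<or> N \<subseteq> U \<and> t = restr F U N s [^]\<^bsub>sections F N\<^esub> n))"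

text \<open>The section "\<open>s\<close> to the power \<open>f\<close>" over \<open>V\<close>,
  given as a relation so that it can be handled before existence and uniqueness are
  established.\<close>

definition is_power :: "'x set \<Rightarrow> 's \<Rightarrow> 'x set \<Rightarrow> ('x \<Rightarrow> int) \<Rightarrow> 's \<Rightarrow> bool" where
  "is_power U s V f t \<longleftrightarrow> t \<in> carrier (sections F V) \<and>
     (\<forall>x\<in>V. \<exists>N. openin X N \<and> x \<in> N \<and> N \<subseteq> V \<and> locally_power U s N f (restr F V N t))"

context
  fixes U s
  assumes U: "openin X U" and s: "s \<in> carrier (sections F U)"
begin

lemma locally_power_closed:
  assumes N: "openin X N" and t: "locally_power U s N f t"
  shows "t \<in> carrier (sections F N)"
proof -
  interpret N: comm_group "sections F N" by (rule comm_group_sections[OF N])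
  show ?thesis using t restr_closed[OF U N _ s] by (auto simp: locally_power_def)
qed

lemma locally_power_unique:
  assumes N: "openin X N" and t: "locally_power U s N f t" "locally_power U s N f t'"
  shows "t = t'"
proof (cases "N = {}")
  \<comment> \<open>Over the empty set the exponent is undetermined, but there all sections are
    equal.\<close>
  case True
  then show ?thesis using sections_empty locally_power_closed[OF N] t by blast
next
  case False
  then obtain x where "x \<in> N" by blast
  then show ?thesis using t unfolding locally_power_def by auto
qed

lemma locally_power_restr:
  assumes N: "openin X N" "openin X N'" "N' \<subseteq> N" and t: "locally_power U s N f t"
    and fg: "\<And>x. x \<in> N' \<Longrightarrow> g x = f x"
  shows "locally_power U s N' g (restr F N N' t)"
proof -
  interpret r: group_hom "sections F N" "sections F N'" "restr F N N'" by (rule group_hom_restr[OF N])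
  obtain n where n: "\<forall>x\<in>N. f x = n"
    and "n = 0 \<and> t = \<one>\<^bsub>sections F N\<^esub> \<or> N \<subseteq> U \<and> t = restr F U N s [^]\<^bsub>sections F N\<^esub> n"
    using t unfolding locally_power_def by blast
  then have "n = 0 \<and> restr F N N' t = \<one>\<^bsub>sections F N'\<^esub> \<or>
      N' \<subseteq> U \<and> restr F N N' t = restr F U N' s [^]\<^bsub>sections F N'\<^esub> n"
  proof (elim disjE conjE)
    assume NU: "N \<subseteq> U" and t: "t = restr F U N s [^]\<^bsub>sections F N\<^esub> n"
    have "restr F N N' t = restr F N N' (restr F U N s) [^]\<^bsub>sections F N'\<^esub> n"
      unfolding t by (rule r.hom_int_pow) (rule restr_closed[OF U N(1) NU s])
    then show ?thesis using N NU restr_restr[OF U N(1,2,3) NU s] by auto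
  qed simp
  moreover have "\<forall>x\<in>N'. g x = n" using n fg N by auto
  ultimately show ?thesis unfolding locally_power_def by blast
qed

lemma locally_power_mult:
  assumes N: "openin X N" and t: "locally_power U s N f t" "locally_power U s N g t'"
  shows "locally_power U s N (\<lambda>x. f x + g x) (t \<otimes>\<^bsub>sections F N\<^esub> t')"
proof -
  interpret N: comm_group "sections F N" by (rule comm_group_sections[OF N])
  obtain n where n: "\<forall>x\<in>N. f x = n"
    "n = 0 \<and> t = \<one>\<^bsub>sections F N\<^esub> \<or> N \<subseteq> U \<and> t = restr F U N s [^]\<^bsub>sections F N\<^esub> n"
    using t(1) unfolding locally_power_def by blast
  obtain m where m: "\<forall>x\<in>N. g x = m"
    "m = 0 \<and> t' = \<one>\<^bsub>sections F N\<^esub> \<or> N \<subseteq> U \<and> t' = restr F U N s [^]\<^bsub>sections F N\<^esub> m"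
    using t(2) unfolding locally_power_def by blast
  have "restr F U N s \<in> carrier (sections F N)" if "N \<subseteq> U" using restr_closed[OF U N that s] .
  then have "n + m = 0 \<and> t \<otimes>\<^bsub>sections F N\<^esub> t' = \<one>\<^bsub>sections F N\<^esub> \<or>
      N \<subseteq> U \<and> t \<otimes>\<^bsub>sections F N\<^esub> t' = restr F U N s [^]\<^bsub>sections F N\<^esub> (n + m)"
    using n(2) m(2) by (auto simp: N.int_pow_mult)
  moreover have "\<forall>x\<in>N. f x + g x = n + m" using n(1) m(1) by simp
  ultimately show ?thesis unfolding locally_power_def by blast
qed

lemma is_power_unique:
  assumes V: "openin X V" and t: "is_power U s V f t" "is_power U s V f t'"
  shows "t = t'"
proof (rule sections_eqI[OF V])
  show tV: "t \<in> carrier (sections F V)" "t' \<in> carrier (sections F V)" using t by (simp_all add: is_power_def)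
  fix x assume x: "x \<in> V"
  obtain N where N: "openin X N" "x \<in> N" "N \<subseteq> V" "locally_power U s N f (restr F V N t)"
    using t(1) x unfolding is_power_def by blast
  obtain M where M: "openin X M" "x \<in> M" "M \<subseteq> V" "locally_power U s M f (restr F V M t')"
    using t(2) x unfolding is_power_def by blast
  have NM: "openin X (N \<inter> M)" using N M by blast
  have "locally_power U s (N \<inter> M) f (restr F V (N \<inter> M) t)"
    using locally_power_restr[OF N(1) NM _ N(4)] restr_restr[OF V N(1) NM _ N(3) tV(1)] by simp
  moreover have "locally_power U s (N \<inter> M) f (restr F V (N \<inter> M) t')"
    using locally_power_restr[OF M(1) NM _ M(4)] restr_restr[OF V M(1) NM _ M(3) tV(2)] by simp
  ultimately have "restr F V (N \<inter> M) t = restr F V (N \<inter> M) t'" by (rule locally_power_unique[OF NM])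
  then show "\<exists>N. openin X N \<and> x \<in> N \<and> N \<subseteq> V \<and> restr F V N t = restr F V N t'"
    using NM N M by (intro exI[of _ "N \<inter> M"]) auto
qed

lemma is_power_exists:
  assumes V: "openin X V" and f: "f \<in> carrier (sections (integer_sheaf X U) V)"
  shows "\<exists>t. is_power U s V f t"
proof -
  define \<U> where "\<U> = {N. openin X N \<and> N \<subseteq> V \<and> (\<exists>t. locally_power U s N f t)}"
  define r where "r = (\<lambda>N. SOME t. locally_power U s N f t)"
  have \<U>_D: "openin X N" "N \<subseteq> V" "locally_power U s N f (r N)" if "N \<in> \<U>" for N
    using that by (auto simp: \<U>_def r_def intro: someI_ex)
  have cover: "\<exists>N\<in>\<U>. x \<in> N" if x: "x \<in> V" for x
  proof -
    obtain N where N: "openin X N" "x \<in> N" "N \<subseteq> V" "\<forall>y\<in>N. f y = f x"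
      using f x unfolding integer_sheaf_carrier by blast
    have "\<exists>t. locally_power U s N f t"
    proof (cases "f x = 0")
      case True
      then show ?thesis using N unfolding locally_power_def by blast
    next
      case False
      \<comment> \<open>\<open>f\<close> is supported in \<open>U\<close>, so a set on which it is
        constant and nonzero lies in \<open>U\<close>.\<close>
      then have "N \<subseteq> U" using N(4) f unfolding integer_sheaf_carrier by (metis subsetI)
      then show ?thesis using N unfolding locally_power_def by blast
    qed
    then show ?thesis using N by (auto simp: \<U>_def)
  qed
  then have UV: "\<Union>\<U> = V" using \<U>_D(2) by blast
  have "\<exists>t \<in> carrier (sections F (\<Union>\<U>)). \<forall>N\<in>\<U>. restr F (\<Union>\<U>) N t = r N"
  proof (rule glue)
    show "openin X N" if "N \<in> \<U>" for N using \<U>_D that by blast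
    show "r N \<in> carrier (sections F N)" if "N \<in> \<U>" for N
      using locally_power_closed \<U>_D[OF that] by blast
    fix N M assume N: "N \<in> \<U>" and M: "M \<in> \<U>"
    have NM: "openin X (N \<inter> M)" using \<U>_D[OF N] \<U>_D[OF M] by blast
    show "restr F N (N \<inter> M) (r N) = restr F M (N \<inter> M) (r M)"
      by (rule locally_power_unique[OF NM];
          rule locally_power_restr[OF _ NM]) (use \<U>_D[OF N] \<U>_D[OF M] in auto)
  qed
  then obtain t where t: "t \<in> carrier (sections F V)" "\<And>N. N \<in> \<U> \<Longrightarrow> restr F V N t = r N"
    unfolding UV by blast
  have "is_power U s V f t" unfolding is_power_def
  proof (intro conjI ballI t)
    fix x assume "x \<in> V"
    then obtain N where N: "N \<in> \<U>" "x \<in> N" using cover by blast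
    then show "\<exists>N. openin X N \<and> x \<in> N \<and> N \<subseteq> V \<and> locally_power U s N f (restr F V N t)"
      using \<U>_D[OF N(1)] t(2)[OF N(1)] by (intro exI[of _ N]) simp
  qed
  then show ?thesis by blast
qed

lemma is_power_restr:
  assumes V: "openin X V" "openin X W" "W \<subseteq> V" and t: "is_power U s V f t"
  shows "is_power U s W (restr (integer_sheaf X U) V W f) (restr F V W t)"
  unfolding is_power_def
proof (intro conjI ballI)
  have tV: "t \<in> carrier (sections F V)" using t by (simp add: is_power_def)
  then show "restr F V W t \<in> carrier (sections F W)" using restr_closed V by blast
  fix x assume x: "x \<in> W"
  then obtain N where N: "openin X N" "x \<in> N" "N \<subseteq> V" "locally_power U s N f (restr F V N t)"
    using t V unfolding is_power_def by blast
  have NW: "openin X (N \<inter> W)" using N V by blast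
  have "locally_power U s (N \<inter> W) (restr (integer_sheaf X U) V W f) (restr F N (N \<inter> W) (restr F V N t))"
    by (rule locally_power_restr[OF N(1) NW _ N(4)]) (auto simp: integer_sheaf_restr)
  moreover have "restr F N (N \<inter> W) (restr F V N t) = restr F W (N \<inter> W) (restr F V W t)"
    using restr_restr[OF V(1) N(1) NW _ N(3) tV] restr_restr[OF V(1,2) NW _ V(3) tV] by simp
  ultimately show "\<exists>N. openin X N \<and> x \<in> N \<and> N \<subseteq> W \<and>
      locally_power U s N (restr (integer_sheaf X U) V W f) (restr F W N (restr F V W t))"
    using NW N x by (intro exI[of _ "N \<inter> W"]) auto
qed

lemma is_power_mult:
  assumes V: "openin X V" and t: "is_power U s V f t" "is_power U s V g t'"
  shows "is_power U s V (\<lambda>x. f x + g x) (t \<otimes>\<^bsub>sections F V\<^esub> t')"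
  unfolding is_power_def
proof (intro conjI ballI)
  interpret V: comm_group "sections F V" by (rule comm_group_sections[OF V])
  have tV: "t \<in> carrier (sections F V)" "t' \<in> carrier (sections F V)" using t by (simp_all add: is_power_def)
  then show "t \<otimes>\<^bsub>sections F V\<^esub> t' \<in> carrier (sections F V)" by simp
  fix x assume x: "x \<in> V"
  obtain N where N: "openin X N" "x \<in> N" "N \<subseteq> V" "locally_power U s N f (restr F V N t)"
    using t(1) x unfolding is_power_def by blast
  obtain M where M: "openin X M" "x \<in> M" "M \<subseteq> V" "locally_power U s M g (restr F V M t')"
    using t(2) x unfolding is_power_def by blast
  have NM: "openin X (N \<inter> M)" "N \<inter> M \<subseteq> V" using N M by blast+
  interpret r: group_hom "sections F V" "sections F (N \<inter> M)" "restr F V (N \<inter> M)"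
    by (rule group_hom_restr[OF V NM])
  have "locally_power U s (N \<inter> M) f (restr F V (N \<inter> M) t)"
    using locally_power_restr[OF N(1) NM(1) _ N(4)] restr_restr[OF V N(1) NM(1) _ N(3) tV(1)] by simp
  moreover have "locally_power U s (N \<inter> M) g (restr F V (N \<inter> M) t')"
    using locally_power_restr[OF M(1) NM(1) _ M(4)] restr_restr[OF V M(1) NM(1) _ M(3) tV(2)] by simp
  ultimately have "locally_power U s (N \<inter> M) (\<lambda>x. f x + g x) (restr F V (N \<inter> M) (t \<otimes>\<^bsub>sections F V\<^esub> t'))"
    using locally_power_mult[OF NM(1)] tV by simp
  then show "\<exists>N. openin X N \<and> x \<in> N \<and> N \<subseteq> V \<and>
      locally_power U s N (\<lambda>x. f x + g x) (restr F V N (t \<otimes>\<^bsub>sections F V\<^esub> t'))"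
    using NM N M by (intro exI[of _ "N \<inter> M"]) auto
qed

definition power_map :: "'x set \<Rightarrow> ('x \<Rightarrow> int) \<Rightarrow> 's" where
  "power_map V f = (THE t. is_power U s V f t)"

lemma power_map_eq: "openin X V \<Longrightarrow> is_power U s V f t \<Longrightarrow> power_map V f = t"
  unfolding power_map_def by (rule the_equality) (auto intro: is_power_unique)

lemma is_power_power_map:
  "openin X V \<Longrightarrow> f \<in> carrier (sections (integer_sheaf X U) V) \<Longrightarrow> is_power U s V f (power_map V f)"
  using is_power_exists power_map_eq by metis

text \<open>The two sides of each identity satisfy the same \<open>is_power\<close> relation, and
  its uniqueness identifies them.\<close>

lemma sheaf_hom_power_map: "sheaf_hom X (integer_sheaf X U) F power_map"
  unfolding sheaf_hom_def
proof (intro conjI allI impI ballI)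
  show "power_map V \<in> hom (sections (integer_sheaf X U) V) (sections F V)" if V: "openin X V" for V
  proof (rule homI)
    show "power_map V f \<in> carrier (sections F V)" if "f \<in> carrier (sections (integer_sheaf X U) V)" for f
      using is_power_power_map[OF V that] by (simp add: is_power_def)
    show "power_map V (f \<otimes>\<^bsub>sections (integer_sheaf X U) V\<^esub> g) = power_map V f \<otimes>\<^bsub>sections F V\<^esub> power_map V g"
      if "f \<in> carrier (sections (integer_sheaf X U) V)" "g \<in> carrier (sections (integer_sheaf X U) V)" for f g
      unfolding integer_sheaf_mult using that V
      by (intro power_map_eq is_power_mult is_power_power_map)
  qed
  show "power_map W (restr (integer_sheaf X U) V W f) = restr F V W (power_map V f)"
    if "openin X V \<and> openin X W \<and> W \<subseteq> V" "f \<in> carrier (sections (integer_sheaf X U) V)" for V W f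
    using that by (intro power_map_eq is_power_restr is_power_power_map) auto
qed

lemma power_map_one: "power_map U (\<lambda>x. if x \<in> U then 1 else 0) = s"
proof (rule power_map_eq[OF U])
  interpret U: comm_group "sections F U" by (rule comm_group_sections[OF U])
  have "locally_power U s U (\<lambda>x. if x \<in> U then 1 else 0) (restr F U U s)"
    unfolding locally_power_def using s restr_id[OF U s] by (intro exI[of _ 1]) simp
  then show "is_power U s U (\<lambda>x. if x \<in> U then 1 else 0) s"
    unfolding is_power_def using s U by blast
qed

end

end

lemma injective_sheaf_flasque:
  fixes X :: "'x topology"
  assumes "injective_sheaf X J"
  shows "flasque_sheaf X J"
  unfolding flasque_sheaf_def
proof (intro conjI allI impI ballI)
  show sheaf: "abelian_sheaf X J" using assms by (simp add: injective_sheaf_def)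
  interpret abelian_sheaf_on X J by unfold_locales (rule sheaf)
  fix U s assume U: "openin X U" and s: "s \<in> carrier (sections J U)"
  \<comment> \<open>Both sheaves have sections of type \<open>'x \<Rightarrow> int\<close>, the type
    against which \<open>injective_sheaf\<close> tests lifting.\<close>
  let ?A = "integer_sheaf X U" and ?B = "integer_sheaf X (topspace X)"
  have mono: "sheaf_mono X ?A ?B (\<lambda>V f. f)"
    unfolding sheaf_mono_def sheaf_hom_def
  proof (intro conjI allI impI ballI)
    show "(\<lambda>f. f) \<in> hom (sections ?A V) (sections ?B V)" if "openin X V" for V
      using openin_subset[OF that] by (intro homI) (auto simp: integer_sheaf_mult integer_sheaf_carrier)
  qed (simp_all add: integer_sheaf_restr)
  have "\<exists>\<theta>. sheaf_hom X ?B J \<theta> \<and> (\<forall>V. openin X V \<longrightarrow>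
      (\<forall>f \<in> carrier (sections ?A V). \<theta> V f = power_map U s V f))"
    by (rule assms[unfolded injective_sheaf_def, THEN conjunct2, THEN spec, of ?A, THEN spec, of ?B,
          THEN spec, of "\<lambda>V f. f", THEN spec, of "power_map U s", THEN mp])
      (intro conjI abelian_sheaf_integer_sheaf mono sheaf_hom_power_map[OF U s])
  then obtain \<theta> where \<theta>: "sheaf_hom X ?B J \<theta>"
    and ext: "\<And>V f. openin X V \<Longrightarrow> f \<in> carrier (sections ?A V) \<Longrightarrow> \<theta> V f = power_map U s V f"
    by blast
  interpret \<theta>: sheaf_morphism X ?B J \<theta>
    by unfold_locales (rule abelian_sheaf_integer_sheaf, rule \<theta>)
  let ?one = "\<lambda>V x. if x \<in> V then 1 else 0 :: int"
  have one: "?one (topspace X) \<in> carrier (sections ?B (topspace X))"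
    and oneU: "?one U \<in> carrier (sections ?A U)"
    using U by (auto simp: integer_sheaf_carrier)
  \<comment> \<open>The constant 1 restricts to the indicator function of \<open>U\<close>, which
    \<open>power_map\<close> sends to \<open>s\<close>; its image under \<open>\<theta>\<close> is
    the desired extension.\<close>
  have "restr ?B (topspace X) U (?one (topspace X)) = ?one U"
    using openin_subset[OF U] by (auto simp: integer_sheaf_restr fun_eq_iff)
  then have "restr J (topspace X) U (\<theta> (topspace X) (?one (topspace X))) = \<theta> U (?one U)"
    using \<theta>.component_restr[OF openin_topspace U openin_subset[OF U] one] by simp
  also have "\<dots> = s" using ext[OF U oneU] power_map_one[OF U s] by simp
  finally show "\<exists>t \<in> carrier (sections J (topspace X)). restr J (topspace X) U t = s"
    using \<theta>.component_closed[OF openin_topspace one] by blast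
qed

section \<open>The spectrum of the binoid algebra\<close>

text \<open>For \<open>Q\<close> in \<open>W\<close> the prime \<K>[r Q] is contained in \<K>[p].
  Open sets are stable under passing to smaller primes, so each one containing \<K>[p] contains
  \<K>[r Q].\<close>

lemma centered_at_monomial_prime:
  fixes P :: "('m::binoid \<Rightarrow>\<^sub>0 'k::field) set"
  assumes sub: "\<And>Q. Q \<in> W \<Longrightarrow> monomial_prime Q \<subseteq> p"
    and spec: "\<And>q. q \<in> (binoid_Spec :: 'm set set) \<Longrightarrow>
      binoid_algebra_ideal q \<in> ring_Spec (binoid_algebra :: ('m \<Rightarrow>\<^sub>0 'k) ring)"
    and W: "openin (ring_Zariski (binoid_algebra :: ('m \<Rightarrow>\<^sub>0 'k) ring)) W" "binoid_algebra_ideal p \<in> W"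
  shows "centered_at (ring_Zariski binoid_algebra) (\<lambda>Q. binoid_algebra_ideal (monomial_prime Q))
    (binoid_algebra_ideal p) W"
  unfolding centered_at_def
proof (intro conjI W allI impI)
  fix V Q
  assume "openin (ring_Zariski (binoid_algebra :: ('m \<Rightarrow>\<^sub>0 'k) ring)) V \<and> binoid_algebra_ideal p \<in> V \<and> Q \<in> W"
  then have V: "openin (ring_Zariski (binoid_algebra :: ('m \<Rightarrow>\<^sub>0 'k) ring)) V" "binoid_algebra_ideal p \<in> V"
    and Q: "Q \<in> W" by auto
  have "Q \<in> ring_Spec binoid_algebra"
    using openin_subset[OF W(1)] Q topspace_ring_Zariski[OF cring_binoid_algebra] by blast
  then have "binoid_algebra_ideal (monomial_prime Q) \<in> ring_Spec (binoid_algebra :: ('m \<Rightarrow>\<^sub>0 'k) ring)"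
    using binoid_prime_ideal_monomial_prime by (intro spec) (simp add: binoid_Spec_def)
  then show "binoid_algebra_ideal (monomial_prime Q) \<in> V"
    using openin_ring_Zariski_generization[OF V] binoid_algebra_ideal_mono[OF sub[OF Q]] by blast
qed

text \<open>The injective resolution is arbitrary, because cohomology is defined relative to a
  chosen one; the vanishing is thus proved for every choice.\<close>

theorem proposition3p46:
  fixes F :: "('m::binoid set, 's) presheaf"
    and i :: "'m set \<Rightarrow> ('m \<Rightarrow>\<^sub>0 'k::field) set"
    and Y :: "('m \<Rightarrow>\<^sub>0 'k) set topology"
    and \<epsilon> :: "('m \<Rightarrow>\<^sub>0 'k) set set \<Rightarrow> 's \<Rightarrow> 't"
    and I :: "nat \<Rightarrow> (('m \<Rightarrow>\<^sub>0 'k) set, 't) presheaf"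
    and d :: "nat \<Rightarrow> ('m \<Rightarrow>\<^sub>0 'k) set set \<Rightarrow> 't \<Rightarrow> 't"
    and j :: nat
  assumes "finitely_generated_binoid TYPE('m)"
    and "cancellative_binoid TYPE('m)"
    and "torsion_free_up_to_nilpotence TYPE('m)"
    and "i = binoid_algebra_ideal"
    and "Y = ring_Zariski (binoid_algebra :: ('m \<Rightarrow>\<^sub>0 'k) ring)"
    and "abelian_sheaf binoid_Zariski F"
    and "injective_resolution Y (pushforward binoid_Zariski i F) \<epsilon> I d"
    and "j \<ge> 1"
  shows "trivial_group (sheaf_cohomology Y I d j)"
proof -
  let ?R = "binoid_algebra :: ('m \<Rightarrow>\<^sub>0 'k) ring"
  let ?G = "pushforward binoid_Zariski i F"
  define c where "c = (\<lambda>P :: ('m \<Rightarrow>\<^sub>0 'k) set. i (monomial_prime P))"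
  have top_Y: "topspace Y = ring_Spec ?R"
    unfolding assms(5) by (rule topspace_ring_Zariski[OF cring_binoid_algebra])
  have i_Spec: "i p \<in> ring_Spec ?R" if "p \<in> binoid_Spec" for p
    unfolding assms(4) by (rule binoid_algebra_ideal_in_Spec[OF assms(2,3) that])
  have prime: "monomial_prime P \<in> binoid_Spec" if "P \<in> ring_Spec ?R" for P
    using binoid_prime_ideal_monomial_prime[OF that] by (simp add: binoid_Spec_def)
  have c_i: "c (i p) = i p" if "p \<in> binoid_Spec" for p
    using that monomial_prime_binoid_algebra_ideal[of p, where 'k = 'k]
    by (simp add: c_def assms(4) binoid_Spec_def)
  have centered: "centered_at Y c (i p) W"
    if "\<And>Q. Q \<in> W \<Longrightarrow> monomial_prime Q \<subseteq> p" "openin Y W" "i p \<in> W" for p W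
    using centered_at_monomial_prime[of W p] that i_Spec unfolding c_def assms(4,5) by blast
  have center_mem: "c P \<in> V" if "openin Y V" "P \<in> V" for V P
  proof -
    have P: "P \<in> ring_Spec ?R" using that openin_subset top_Y by blast
    then show ?thesis
      using openin_ring_Zariski_generization[of ?R V P "c P"] that i_Spec[OF prime[OF P]]
        binoid_algebra_ideal_monomial_prime_subset[OF P]
      unfolding c_def assms(4,5) by blast
  qed
  have res: "centered_resolution Y ?G \<epsilon> I d c"
  proof
    show "abelian_sheaf Y ?G" "sheaf_mono Y ?G (I 0) \<epsilon>" "sheaf_exact Y ?G (I 0) (I 1) \<epsilon> (d 0)"
      using assms(7) by (simp_all add: injective_resolution_def)
    fix n
    show "sheaf_hom Y (I n) (I (Suc n)) (d n)"
      "sheaf_exact Y (I n) (I (Suc n)) (I (Suc (Suc n))) (d n) (d (Suc n))"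
      using assms(7) by (simp_all add: injective_resolution_def)
    show "flasque_sheaf Y (I n)"
      by (rule injective_sheaf_flasque) (use assms(7) in \<open>simp add: injective_resolution_def\<close>)
  next
    show "c y \<in> V" if "openin Y V" "y \<in> V" for V y using center_mem that .
  next
    fix P assume "P \<in> topspace Y"
    then have P: "P \<in> ring_Spec ?R" by (simp add: top_Y)
    obtain f where f: "f \<notin> monomial_prime P"
      and min: "\<And>q. binoid_prime_ideal q \<Longrightarrow> f \<notin> q \<Longrightarrow> q \<subseteq> monomial_prime P"
      using binoid_prime_ideal_minimal_basic_open[OF assms(1) binoid_prime_ideal_monomial_prime[OF P]] by blast
    \<comment> \<open>\<open>D(f)\<close> is the smallest neighbourhood of \<open>r P\<close>, so
      every prime \<open>Q\<close> in \<open>D(T\<^sup>f)\<close> has \<open>r Q\<close> contained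
      in \<open>r P\<close>.\<close>
    define N where "N = {Q \<in> ring_Spec ?R. Poly_Mapping.single f 1 \<notin> Q}"
    have f_inf: "f \<noteq> binf" using f by (auto simp: monomial_prime_def)
    have N: "openin Y N" unfolding N_def assms(5)
      by (rule openin_ring_Zariski_basic) (rule single_in_binoid_algebra[OF f_inf])
    have PN: "P \<in> N" using P f by (simp add: N_def monomial_prime_def)
    have "centered_at Y c (i (monomial_prime P)) N"
    proof (rule centered[OF _ N])
      show "i (monomial_prime P) \<in> N" using center_mem[OF N PN] by (simp add: c_def)
      show "monomial_prime Q \<subseteq> monomial_prime P" if "Q \<in> N" for Q
        using that f_inf binoid_prime_ideal_monomial_prime[of Q]
        by (intro min) (auto simp: N_def monomial_prime_def)
    qed
    then show "\<exists>N. P \<in> N \<and> centered_at Y c (c P) N" using PN by (auto simp: c_def)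
  next
    fix e W V s
    assume W: "centered_at Y c e W" and V: "openin Y V" "V \<subseteq> W" "e \<in> V"
      and s: "s \<in> carrier (sections ?G V)"
    let ?trace = "\<lambda>V. {p \<in> topspace binoid_Zariski. i p \<in> V}"
    \<comment> \<open>A point in the image of \<open>i\<close> is its own center, so it lies in
      \<open>V\<close> once it lies in \<open>W\<close>. Hence \<open>V\<close> and \<open>W\<close>
      have the same trace, and restriction of \<open>?G\<close> from \<open>W\<close> to
      \<open>V\<close> is the identity.\<close>
    have "i p \<in> V" if "p \<in> binoid_Spec" "i p \<in> W" for p
      using W V that c_i[OF that(1)] unfolding centered_at_def by metis
    then have trace: "?trace W = ?trace V" using V by (auto simp: topspace_binoid_Zariski)
    have "openin binoid_Zariski (?trace V)"
      using openin_continuous_map_preimage[OF continuous_map_binoid_algebra_ideal[OF assms(2,3)]] V(1)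
      unfolding assms(4,5) by blast
    then have "restr F (?trace V) (?trace V) s = s"
      using s assms(6) by (simp add: pushforward_def abelian_sheaf_def abelian_presheaf_def)
    then have "restr ?G W V s = s" by (simp add: pushforward_def trace)
    moreover have "s \<in> carrier (sections ?G W)" using s by (simp add: pushforward_def trace)
    ultimately show "\<exists>t \<in> carrier (sections ?G W). restr ?G W V t = s" by blast
  qed
  interpret centered_resolution Y ?G \<epsilon> I d c by (rule res)
  obtain n where j: "j = Suc n" using assms(8) by (cases j) auto
  show ?thesis unfolding j
  proof (rule trivial_cohomology)
    fix z assume z: "z \<in> cocycles (Suc n) (topspace Y)"
    show "\<exists>w \<in> carrier (sections (I n) (topspace Y)). d n (topspace Y) w = z"
    proof (cases "topspace Y = {}")
      \<comment> \<open>An empty spectrum offers no center, but then any two sections are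
        equal.\<close>
      case True
      interpret E: group "sections (I n) {}" by (rule I.group_sections) simp
      have "d n {} \<one>\<^bsub>sections (I n) {}\<^esub> \<in> carrier (sections (I (Suc n)) {})"
        by (rule d.component_closed) simp_all
      then have "d n {} \<one>\<^bsub>sections (I n) {}\<^esub> = z"
        by (rule I.sections_empty) (use z in \<open>simp only: True cocycles_iff\<close>)
      then show ?thesis unfolding True by blast
    next
      case False
      then obtain P where P: "P \<in> ring_Spec ?R" using top_Y by blast
      \<comment> \<open>The existence of a prime excludes the zero binoid. The nonunits then form a
        prime containing every \<open>r Q\<close>, so the whole spectrum is centered.\<close>
      have "(0 :: 'm) \<noteq> binf"
        using binoid_prime_idealD(1,4)[OF binoid_prime_ideal_monomial_prime[OF P]] by metis
      then have max: "{a :: 'm. \<forall>b. a + b \<noteq> 0} \<in> binoid_Spec"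
        using binoid_prime_ideal_nonunits by (simp add: binoid_Spec_def)
      have "centered_at Y c (i {a. \<forall>b. a + b \<noteq> 0}) (topspace Y)"
      proof (rule centered)
        show "monomial_prime Q \<subseteq> {a. \<forall>b. a + b \<noteq> 0}" if "Q \<in> topspace Y" for Q
          using that top_Y binoid_prime_ideal_monomial_prime binoid_prime_ideal_subset_nonunits by blast
        show "i {a. \<forall>b. a + b \<noteq> 0} \<in> topspace Y" using i_Spec[OF max] top_Y by simp
      qed simp
      then show ?thesis using cocycle_lift z by blast
    qed
  qed
qed

end
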